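(* For first-passage percolation with stationary-ergodic edge-weights $\tau$ satisfying $0<a\le\tau\le b<\infty$, the limiting Hamiltonian $\overline{H}$ is given, for every $p\in\mathbb{R}^d$, by $$\overline{H}(p)=\inf_{\phi\in S}\ \operatorname*{ess\,sup}_{\omega\in\Omega}\ \sup_{x\in\mathbb{Z}^d}\mathcal{H}(\phi,p,x,\omega).$$
   Context: Let $d\ge 1$, $A=\{\pm e_1,\dots,\pm e_d\}$ with $e_i$ the canonical basis of $\mathbb{Z}^d$, and $(\Omega,\mathcal{F},\mathbb{P})$ a probability space with invertible measure-preserving maps $\{V_z\}_{z\in\mathbb{Z}^d}$, $V_{z+w}=V_z\circ V_w$, that are ergodic (every event $B$ with $V_zB=B$ for every $z$ has probability $0$ or $1$). The edge-weights $\tau:\mathbb{Z}^d\times A\times\Omega\to\mathbb{R}$ ($\tau(x,\alpha,\omega)$ is the weight of the directed edge from $x$ to $x+\alpha$) are stationary: $\tau(x+z,\alpha,\omega)=\tau(x,\alpha,V_z\omega)$ for all $x,z\in\mathbb{Z}^d$, and $0<a=\operatorname{ess\,inf}_{x,\alpha,\omega}\tau$, $b=\operatorname{ess\,sup}_{x,\alpha,\omega}\tau<\infty$. Limiting Hamiltonian: for $p\in\mathbb{R}^d$, $x\in\mathbb{Z}^d$, $t\ge 0$ let $\mu_p(x,t)$ be the infimum, over all integers $k\ge0$ and all nearest-neighbour paths $x=v_0,v_1,\dots,v_k$ in $\mathbb{Z}^d$ with $\sum_{i=0}^{k-1}\tau(v_i,v_{i+1}-v_i,\omega)\le t$, of $\sum_{i=0}^{k-1}p\cdot(v_{i+1}-v_i)$.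 Then $\overline{H}(p)=-\lim_{t\to\infty}\mu_p(0,t)/t$ (the a.s. deterministic limit, which exists). For $\phi:\mathbb{Z}^d\times\Omega\to\mathbb{R}$ (measurable in $\omega$) the discrete derivative is $\mathcal{D}\phi(x,\alpha,\omega)=\phi(x+\alpha,\omega)-\phi(x,\omega)$, $\alpha\in A$, and the discrete Hamiltonian is $$\mathcal{H}(\phi,p,x,\omega)=\sup_{\alpha\in A}\frac{-\mathcal{D}\phi(x,\alpha,\omega)-p\cdot\alpha}{\tau(x,\alpha,\omega)}.$$ $S$ is the set of all such $\phi$ with $\mathcal{D}\phi(x+z,\alpha,\omega)=\mathcal{D}\phi(x,\alpha,V_z\omega)$ for all $x,z\in\mathbb{Z}^d$, $\alpha\in A$, and $E[\mathcal{D}\phi(x,\alpha)]=0$ for all $x\in\mathbb{Z}^d$, $\alpha\in A$. *)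

theory Defs
  imports "HOL-Probability.Probability"
begin

definition directions :: "(int ^ 'd::finite) set" where
  "directions = {v. \<exists>i. v = axis i 1 \<or> v = - axis i 1}"

definition rvec :: "int ^ 'd::finite \<Rightarrow> real ^ 'd" where
  "rvec z = (\<chi> i. real_of_int (z $ i))"

text \<open>An ergodic action of the group \<open>\<int>\<^sup>d\<close> on a probability space by invertible
  measure-preserving maps. The group law and bijectivity force \<open>V 0\<close> to be the identity on
  the space, so \<open>V (- z)\<close> is the (measurable) inverse of \<open>V z\<close>.\<close>

locale ergodic_action = prob_space M
  for M :: "'w measure" and V :: "int ^ 'd::finite \<Rightarrow> 'w \<Rightarrow> 'w" +
  assumes V_measurable: "\<And>z. V z \<in> M \<rightarrow>\<^sub>M M"
    and V_preserves: "\<And>z. distr M M (V z) = M"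
    and V_invertible: "\<And>z. bij_betw (V z) (space M) (space M)"
    and V_add: "\<And>z w \<omega>. \<omega> \<in> space M \<Longrightarrow> V (z + w) \<omega> = V z (V w \<omega>)"
    and V_ergodic: "\<And>B. B \<in> events \<Longrightarrow> (\<And>z. V z ` B = B) \<Longrightarrow> prob B = 0 \<or> prob B = 1"

text \<open>Like \<^const>\<open>esssup\<close>, to which it is dual, \<open>essinf\<close> degenerates (to \<open>- \<infinity>\<close>) on
  non-measurable functions.\<close>

definition essinf :: "'a measure \<Rightarrow> ('a \<Rightarrow> ereal) \<Rightarrow> ereal" where
  "essinf M f = - esssup M (\<lambda>x. - f x)"

text \<open>The essential infimum and supremum of the weights are taken jointly over the
  (countably many) directed edges \<open>(x, \<alpha>)\<close> and over \<open>\<omega>\<close>.\<close>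

definition weight_space :: "'w measure \<Rightarrow> (((int ^ 'd::finite) \<times> (int ^ 'd)) \<times> 'w) measure" where
  "weight_space M = count_space (UNIV \<times> directions) \<Otimes>\<^sub>M M"

definition weight :: "(int ^ 'd::finite \<Rightarrow> int ^ 'd \<Rightarrow> 'w \<Rightarrow> real)
    \<Rightarrow> ((int ^ 'd) \<times> (int ^ 'd)) \<times> 'w \<Rightarrow> ereal" where
  "weight \<tau> = (\<lambda>((x, \<alpha>), \<omega>). ereal (\<tau> x \<alpha> \<omega>))"

definition is_path :: "int ^ 'd::finite \<Rightarrow> nat \<Rightarrow> (nat \<Rightarrow> int ^ 'd) \<Rightarrow> bool" where
  "is_path x k v \<longleftrightarrow> v 0 = x \<and> (\<forall>i<k. v (Suc i) - v i \<in> directions)"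

text \<open>For \<open>t \<ge> 0\<close> the set below is nonempty (take \<open>k = 0\<close>), and it is bounded below for every
  \<open>\<omega>\<close> at which the weights have a positive lower bound, i.e. almost surely; so almost surely the
  real infimum is the genuine one.\<close>

definition reach_inf :: "(int ^ 'd::finite \<Rightarrow> int ^ 'd \<Rightarrow> 'w \<Rightarrow> real)
    \<Rightarrow> real ^ 'd \<Rightarrow> int ^ 'd \<Rightarrow> real \<Rightarrow> 'w \<Rightarrow> real" where
  "reach_inf \<tau> p x t \<omega> = Inf {(\<Sum>i<k. p \<bullet> rvec (v (Suc i) - v i)) | k v.
     is_path x k v \<and> (\<Sum>i<k. \<tau> (v i) (v (Suc i) - v i) \<omega>) \<le> t}"

text \<open>The limit is almost surely a deterministic constant; the definite description picks out
  that constant.\<close>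

definition limiting_hamiltonian :: "'w measure \<Rightarrow> (int ^ 'd::finite \<Rightarrow> int ^ 'd \<Rightarrow> 'w \<Rightarrow> real)
    \<Rightarrow> real ^ 'd \<Rightarrow> real" where
  "limiting_hamiltonian M \<tau> p =
     (THE h. AE \<omega> in M. ((\<lambda>t. reach_inf \<tau> p 0 t \<omega> / t) \<longlongrightarrow> - h) at_top)"

definition discrete_deriv :: "(int ^ 'd::finite \<Rightarrow> 'w \<Rightarrow> real)
    \<Rightarrow> int ^ 'd \<Rightarrow> int ^ 'd \<Rightarrow> 'w \<Rightarrow> real" where
  "discrete_deriv \<phi> x \<alpha> \<omega> = \<phi> (x + \<alpha>) \<omega> - \<phi> x \<omega>"

definition discrete_hamiltonian :: "(int ^ 'd::finite \<Rightarrow> int ^ 'd \<Rightarrow> 'w \<Rightarrow> real)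
    \<Rightarrow> (int ^ 'd \<Rightarrow> 'w \<Rightarrow> real) \<Rightarrow> real ^ 'd \<Rightarrow> int ^ 'd \<Rightarrow> 'w \<Rightarrow> real" where
  "discrete_hamiltonian \<tau> \<phi> p x \<omega> =
     (SUP \<alpha>\<in>directions. (- discrete_deriv \<phi> x \<alpha> \<omega> - p \<bullet> rvec \<alpha>) / \<tau> x \<alpha> \<omega>)"

text \<open>Integrability is required explicitly because the Bochner integral of a non-integrable
  function is \<open>0\<close> by convention.\<close>

definition correctors :: "'w measure \<Rightarrow> (int ^ 'd::finite \<Rightarrow> 'w \<Rightarrow> 'w)
    \<Rightarrow> (int ^ 'd \<Rightarrow> 'w \<Rightarrow> real) set" where
  "correctors M V = {\<phi>.
     (\<forall>x. \<phi> x \<in> borel_measurable M) \<and>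
     (\<forall>x z. \<forall>\<alpha>\<in>directions. \<forall>\<omega>\<in>space M.
        discrete_deriv \<phi> (x + z) \<alpha> \<omega> = discrete_deriv \<phi> x \<alpha> (V z \<omega>)) \<and>
     (\<forall>x. \<forall>\<alpha>\<in>directions. integrable M (discrete_deriv \<phi> x \<alpha>) \<and>
        integral\<^sup>L M (discrete_deriv \<phi> x \<alpha>) = 0)}"

end

theory Submission
  imports Defs
begin

text \<open>
  For \<open>\<kappa> \<ge> 0\<close> charge a path the cost \<open>\<kappa> * (passage time) + p \<bullet> (displacement)\<close>. Both sides of
  the formula are the critical \<open>\<kappa>\<close> above which the cost of all paths from a point is bounded below.

  The bridge between them is deterministic. Let \<open>T x y\<close> be the first-passage time and let
  \<open>time_constant z\<close> be the limit of \<open>T 0 (n z) / n\<close>. Put \<open>effective_hamiltonian p\<close> for the least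
  \<open>\<kappa> \<ge> 0\<close> with \<open>0 \<le> \<kappa> * time_constant z + p \<bullet> z\<close> for every lattice direction \<open>z\<close>, that is, for
  the dual of the (asymmetric) norm \<open>time_constant\<close> at \<open>- p\<close>. Three facts give the theorem.

  \<^item> The reach rate \<open>\<mu>\<^sub>p(0, t) / t\<close> tends to \<open>- effective_hamiltonian p\<close>. If \<open>\<kappa>\<close> is below the
    effective Hamiltonian, some ray \<open>z\<close> has \<open>\<kappa> * time_constant z + p \<bullet> z < 0\<close>, and walking along it
    gives reach at most \<open>- \<kappa> t\<close> up to a constant. If \<open>\<kappa>\<close> is above, then
    \<open>\<kappa> * T 0 y + p \<bullet> y\<close> is almost surely bounded below in \<open>y\<close>
    (\<open>uniform_lower_bound\<close>, a shape theorem), and this bounds the reach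
    from below by \<open>- \<kappa> t\<close> up to a constant.

  \<^item> Every corrector value is an upper bound. If the discrete Hamiltonian of \<open>\<phi>\<close> is at most \<open>\<kappa>\<close>,
    summing over a path gives \<open>\<phi> 0 - \<phi> y \<le> \<kappa> * T 0 y + p \<bullet> y\<close>. Increments of \<open>\<phi>\<close> have
    mean zero, so expectations along a ray give \<open>0 \<le> \<kappa> * time_constant z + p \<bullet> z\<close>.

  \<^item> For \<open>\<kappa>\<close> above the effective Hamiltonian, \<open>\<phi> x = inf\<^sub>y (\<kappa> * T x y + p \<bullet> (y - x))\<close> is almost
    surely finite by the same uniform lower bound. It is itself stationary, so its bounded increments
    have mean zero, and the triangle inequality for \<open>T\<close> says that its discrete Hamiltonian is
    at most \<open>\<kappa>\<close>.

  The probabilistic input is the convergence along rays. Both halves of it come from one inequality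
  for subadditive processes (\<open>expectation_subadditive_le\<close>), applied to \<open>T 0 (n z)\<close> for the
  lower bound and to the deficits \<open>C m - T 0 (m z)\<close> summed along an orbit for the upper bound.
  Ergodicity of the whole \<open>\<int>\<^sup>d\<close>-action enters through a zero-one law: a linear bound on the ray up
  to an additive constant is an invariant property, since shifting the environment changes every
  \<open>T 0 y\<close> by a bounded amount. The zero-one law is for the whole action because a single \<open>V z\<close> may
  fail to be ergodic.
\<close>

section \<open>Lattice steps and routes\<close>

definition l1 :: "int ^ 'd::finite \<Rightarrow> int" where
  "l1 y = (\<Sum>i\<in>UNIV. \<bar>y $ i\<bar>)"

lemma l1_nonneg: "0 \<le> l1 y"
  by (simp add: l1_def sum_nonneg)

lemma l1_zero [simp]: "l1 0 = 0"
  by (simp add: l1_def)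

lemma l1_eq_0_iff [simp]: "l1 y = 0 \<longleftrightarrow> y = 0"
  by (simp add: l1_def sum_nonneg_eq_0_iff vec_eq_iff)

lemma l1_uminus [simp]: "l1 (- y) = l1 y"
  by (simp add: l1_def)

lemma l1_add: "l1 (x + y) \<le> l1 x + l1 y"
  unfolding l1_def sum.distrib[symmetric] by (intro sum_mono) (simp add: abs_triangle_ineq)

lemma l1_scale: "l1 (c *s z) = \<bar>c\<bar> * l1 z"
  by (simp add: l1_def sum_distrib_left abs_mult)

lemma l1_axis [simp]: "l1 (axis i 1) = 1"
  by (simp add: l1_def axis_def if_distrib cong: if_cong)

lemma l1_direction: "\<alpha> \<in> directions \<Longrightarrow> l1 \<alpha> = 1"
  by (auto simp: directions_def)

lemma directions_eq: "directions = range (\<lambda>i. axis i 1) \<union> range (\<lambda>i. - axis i 1)"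
  by (auto simp: directions_def)

lemma finite_directions [simp]: "finite directions"
  by (simp add: directions_eq)

lemma directions_nonempty: "directions \<noteq> {}"
  by (simp add: directions_eq)

lemma uminus_direction: "\<alpha> \<in> directions \<Longrightarrow> - \<alpha> \<in> directions"
  by (auto simp: directions_def)

lemma rvec_add: "rvec (x + y) = rvec x + rvec y"
  by (simp add: rvec_def vec_eq_iff)

lemma rvec_zero [simp]: "rvec 0 = 0"
  by (simp add: rvec_def vec_eq_iff)

lemma rvec_diff: "rvec (x - y) = rvec x - rvec y"
  by (simp add: rvec_def vec_eq_iff)

lemma rvec_scale: "rvec (c *s z) = real_of_int c *\<^sub>R rvec z"
  by (simp add: rvec_def vec_eq_iff)

lemma abs_inner_rvec_le: "\<bar>p \<bullet> rvec y\<bar> \<le> norm p * l1 y"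
proof -
  have "norm (rvec y) \<le> l1 y"
    using norm_le_l1_cart[of "rvec y"] by (simp add: rvec_def l1_def)
  then show ?thesis
    by (meson Cauchy_Schwarz_ineq2 mult_left_mono norm_ge_zero order_trans)
qed

lemma finite_l1_ball: "finite {z :: int ^ 'd::finite. l1 z \<le> R}"
proof -
  have "z \<in> vec_lambda ` (UNIV \<rightarrow>\<^sub>E {-R..R})" if "l1 z \<le> R" for z :: "int ^ 'd"
  proof
    have "\<bar>z $ i\<bar> \<le> R" for i
      using that member_le_sum[of i UNIV "\<lambda>i. \<bar>z $ i\<bar>"] by (simp add: l1_def)
    then show "vec_nth z \<in> UNIV \<rightarrow>\<^sub>E {-R..R}"
      by (auto simp: abs_le_iff minus_le_iff[of R])
  qed simp
  then have "{z :: int ^ 'd. l1 z \<le> R} \<subseteq> vec_lambda ` (UNIV \<rightarrow>\<^sub>E {-R..R})" by auto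
  then show ?thesis by (rule finite_subset) (simp add: finite_PiE)
qed

lemma l1_sum_list_le: "set ds \<subseteq> directions \<Longrightarrow> l1 (sum_list ds) \<le> int (length ds)"
proof (induction ds)
  case (Cons \<alpha> ds)
  then show ?case using l1_add[of \<alpha> "sum_list ds"] by (simp add: l1_direction)
qed simp

text \<open>Paths are encoded by their lists of steps: those of any length from any starting point then form
  a countable set, which makes the infima below measurable.\<close>

definition routes :: "int ^ 'd::finite \<Rightarrow> (int ^ 'd) list set" where
  "routes z = {ds. set ds \<subseteq> directions \<and> sum_list ds = z}"

lemma ex_short_route: "\<exists>ds \<in> routes z. int (length ds) = l1 z"
proof (induction "nat (l1 z)" arbitrary: z)
  case 0
  then have "z = 0" using l1_nonneg[of z] by (simp flip: l1_eq_0_iff)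
  then show ?case by (auto simp: routes_def intro!: bexI[of _ "[]"])
next
  case (Suc n)
  then have "z \<noteq> 0" by auto
  then obtain i where i: "z $ i \<noteq> 0" by (auto simp: vec_eq_iff)
  define \<alpha> where "\<alpha> = (if z $ i > 0 then axis i 1 else - axis i (1::int))"
  have \<alpha>: "\<alpha> \<in> directions" by (auto simp: \<alpha>_def directions_def)
  have "l1 z = \<bar>z $ i\<bar> + (\<Sum>j\<in>UNIV - {i}. \<bar>z $ j\<bar>)"
    unfolding l1_def by (subst sum.remove[of _ i]) auto
  moreover have "l1 (z - \<alpha>) = \<bar>(z - \<alpha>) $ i\<bar> + (\<Sum>j\<in>UNIV - {i}. \<bar>(z - \<alpha>) $ j\<bar>)"
    unfolding l1_def by (subst sum.remove[of _ i]) auto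
  moreover have "(\<Sum>j\<in>UNIV - {i}. \<bar>(z - \<alpha>) $ j\<bar>) = (\<Sum>j\<in>UNIV - {i}. \<bar>z $ j\<bar>)"
    by (intro sum.cong) (auto simp: \<alpha>_def axis_def)
  moreover have "\<bar>(z - \<alpha>) $ i\<bar> = \<bar>z $ i\<bar> - 1"
    using i by (auto simp: \<alpha>_def axis_def)
  ultimately have l: "l1 (z - \<alpha>) = l1 z - 1" by simp
  then have "n = nat (l1 (z - \<alpha>))" using Suc by simp
  from Suc.hyps(1)[OF this] obtain ds where "ds \<in> routes (z - \<alpha>)" "int (length ds) = l1 (z - \<alpha>)"
    by blast
  then show ?case
    using \<alpha> l by (intro bexI[of _ "\<alpha> # ds"]) (auto simp: routes_def)
qed

lemma routes_nonempty: "routes z \<noteq> {}"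
  using ex_short_route by blast

lemma routes_append: "ds \<in> routes x \<Longrightarrow> es \<in> routes y \<Longrightarrow> ds @ es \<in> routes (x + y)"
  by (auto simp: routes_def)

primrec passage :: "(int ^ 'd::finite \<Rightarrow> int ^ 'd \<Rightarrow> 'w \<Rightarrow> real)
    \<Rightarrow> int ^ 'd \<Rightarrow> (int ^ 'd) list \<Rightarrow> 'w \<Rightarrow> real" where
  "passage \<tau> x [] \<omega> = 0"
| "passage \<tau> x (\<alpha> # ds) \<omega> = \<tau> x \<alpha> \<omega> + passage \<tau> (x + \<alpha>) ds \<omega>"

lemma passage_append:
  "passage \<tau> x (ds @ es) \<omega> = passage \<tau> x ds \<omega> + passage \<tau> (x + sum_list ds) es \<omega>"
  by (induction ds arbitrary: x) (simp_all add: add_ac)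

lemma passage_cong:
  assumes "\<And>x \<alpha>. \<alpha> \<in> directions \<Longrightarrow> \<tau> x \<alpha> \<omega> = \<tau>' x \<alpha> \<omega>"
  shows "set ds \<subseteq> directions \<Longrightarrow> passage \<tau> x ds \<omega> = passage \<tau>' x ds \<omega>"
  by (induction ds arbitrary: x) (simp_all add: assms)

lemma steps_of_path:
  "is_path x k v \<Longrightarrow> \<exists>ds. set ds \<subseteq> directions \<and> x + sum_list ds = v k \<and>
     passage \<tau> x ds \<omega> = (\<Sum>i<k. \<tau> (v i) (v (Suc i) - v i) \<omega>) \<and>
     p \<bullet> rvec (sum_list ds) = (\<Sum>i<k. p \<bullet> rvec (v (Suc i) - v i))"
proof (induction k)
  case 0
  then show ?case by (auto simp: is_path_def intro!: exI[of _ "[]"])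
next
  case (Suc k)
  then obtain ds where ds: "set ds \<subseteq> directions" "x + sum_list ds = v k"
     "passage \<tau> x ds \<omega> = (\<Sum>i<k. \<tau> (v i) (v (Suc i) - v i) \<omega>)"
     "p \<bullet> rvec (sum_list ds) = (\<Sum>i<k. p \<bullet> rvec (v (Suc i) - v i))"
    by (auto simp: is_path_def)
  have "v (Suc k) - v k \<in> directions" using Suc.prems by (simp add: is_path_def)
  moreover have "x + (sum_list ds + (v (Suc k) - v k)) = v (Suc k)"
    using ds(2) by (simp flip: add.assoc)
  ultimately show ?case using ds
    by (intro exI[of _ "ds @ [v (Suc k) - v k]"])
       (auto simp: passage_append rvec_add inner_add_right)
qed

lemma path_of_steps:
  "set ds \<subseteq> directions \<Longrightarrow> \<exists>k v. is_path x k v \<and>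
     passage \<tau> x ds \<omega> = (\<Sum>i<k. \<tau> (v i) (v (Suc i) - v i) \<omega>) \<and>
     p \<bullet> rvec (sum_list ds) = (\<Sum>i<k. p \<bullet> rvec (v (Suc i) - v i))"
proof (induction ds arbitrary: x)
  case Nil
  show ?case by (rule exI[of _ 0], rule exI[of _ "\<lambda>_. x"]) (simp add: is_path_def)
next
  case (Cons \<alpha> ds)
  then obtain k v where v: "is_path (x + \<alpha>) k v"
     "passage \<tau> (x + \<alpha>) ds \<omega> = (\<Sum>i<k. \<tau> (v i) (v (Suc i) - v i) \<omega>)"
     "p \<bullet> rvec (sum_list ds) = (\<Sum>i<k. p \<bullet> rvec (v (Suc i) - v i))"
    by fastforce
  define w where "w = (\<lambda>i. case i of 0 \<Rightarrow> x | Suc j \<Rightarrow> v j)"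
  have w: "w 0 = x" "w (Suc j) = v j" for j by (simp_all add: w_def)
  have "w (Suc i) - w i \<in> directions" if "i < Suc k" for i
    using that v(1) Cons.prems by (cases i) (auto simp: w is_path_def)
  with v have "is_path x (Suc k) w" by (simp add: is_path_def w)
  moreover have "v 0 = x + \<alpha>" using v by (simp add: is_path_def)
  ultimately show ?case using v(2,3)
    by (intro exI[of _ "Suc k"] exI[of _ w])
       (simp add: w sum.lessThan_Suc_shift rvec_add inner_add_right del: sum.lessThan_Suc)
qed

text \<open>Passing from vertex sequences to step lists loses nothing, because only the first \<open>k\<close> steps of a
  sequence enter the infimum.\<close>

lemma reach_inf_eq:
  "reach_inf \<tau> p x t \<omega> =
     Inf {p \<bullet> rvec (sum_list ds) | ds. set ds \<subseteq> directions \<and> passage \<tau> x ds \<omega> \<le> t}"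
  unfolding reach_inf_def
proof (rule arg_cong[where f = Inf], intro equalityI subsetI)
  fix r assume "r \<in> {(\<Sum>i<k. p \<bullet> rvec (v (Suc i) - v i)) | k v.
     is_path x k v \<and> (\<Sum>i<k. \<tau> (v i) (v (Suc i) - v i) \<omega>) \<le> t}"
  then obtain k v where "r = (\<Sum>i<k. p \<bullet> rvec (v (Suc i) - v i))" "is_path x k v"
    "(\<Sum>i<k. \<tau> (v i) (v (Suc i) - v i) \<omega>) \<le> t" by blast
  moreover from this(2) steps_of_path[of x k v \<tau> \<omega> p] obtain ds where
    "set ds \<subseteq> directions" "passage \<tau> x ds \<omega> = (\<Sum>i<k. \<tau> (v i) (v (Suc i) - v i) \<omega>)"
    "p \<bullet> rvec (sum_list ds) = (\<Sum>i<k. p \<bullet> rvec (v (Suc i) - v i))" by blast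
  ultimately
  show "r \<in> {p \<bullet> rvec (sum_list ds) | ds. set ds \<subseteq> directions \<and> passage \<tau> x ds \<omega> \<le> t}"
    by (intro CollectI exI[of _ ds]) auto
next
  fix r assume "r \<in> {p \<bullet> rvec (sum_list ds) | ds. set ds \<subseteq> directions \<and> passage \<tau> x ds \<omega> \<le> t}"
  then obtain ds where "r = p \<bullet> rvec (sum_list ds)" "set ds \<subseteq> directions" "passage \<tau> x ds \<omega> \<le> t"
    by blast
  moreover from this(2) path_of_steps[of ds x \<tau> \<omega> p] obtain k v where
    "is_path x k v" "passage \<tau> x ds \<omega> = (\<Sum>i<k. \<tau> (v i) (v (Suc i) - v i) \<omega>)"
    "p \<bullet> rvec (sum_list ds) = (\<Sum>i<k. p \<bullet> rvec (v (Suc i) - v i))" by blast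
  ultimately
  show "r \<in> {(\<Sum>i<k. p \<bullet> rvec (v (Suc i) - v i)) | k v.
     is_path x k v \<and> (\<Sum>i<k. \<tau> (v i) (v (Suc i) - v i) \<omega>) \<le> t}"
    by (intro CollectI exI[of _ k] exI[of _ v]) auto
qed

lemma reach_inf_cong:
  assumes "\<And>x \<alpha>. \<alpha> \<in> directions \<Longrightarrow> \<tau> x \<alpha> \<omega> = \<tau>' x \<alpha> \<omega>"
  shows "reach_inf \<tau> p x t \<omega> = reach_inf \<tau>' p x t \<omega>"
proof -
  have "{p \<bullet> rvec (sum_list ds) | ds. set ds \<subseteq> directions \<and> passage \<tau> x ds \<omega> \<le> t}
      = {p \<bullet> rvec (sum_list ds) | ds. set ds \<subseteq> directions \<and> passage \<tau>' x ds \<omega> \<le> t}"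
    using passage_cong[of \<tau> \<omega> \<tau>', OF assms] by (intro Collect_cong ex_cong1) auto
  then show ?thesis by (simp add: reach_inf_eq)
qed

section \<open>Subadditive processes over a measure-preserving map\<close>

lemma (in prob_space) AE_witness:
  assumes "AE \<omega> in M. P \<omega>"
  shows "\<exists>\<omega>\<in>space M. P \<omega>"
proof (rule ccontr)
  assume "\<not> (\<exists>\<omega>\<in>space M. P \<omega>)"
  then have "AE \<omega> in M. \<not> P \<omega>" by (intro AE_I2) auto
  with assms show False by (rule AE_contr)
qed

text \<open>The lower half of Kingman's theorem in the form of Katznelson and Weiss. Outside an event \<open>B N\<close> of
  small probability a time \<open>l \<le> N\<close> with \<open>X l \<le> c * l\<close> exists. Cutting \<open>{0..<n}\<close> greedily at such
  times, and into unit pieces while the orbit is in \<open>B N\<close>, bounds \<open>X n\<close> by \<open>c * n\<close> plus \<open>C\<close> times the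
  number of visits to \<open>B N\<close>, whose expectation is \<open>n * prob (B N)\<close>.\<close>

lemma (in prob_space) expectation_subadditive_le:
  fixes X :: "nat \<Rightarrow> 'a \<Rightarrow> real"
  assumes S: "S \<in> M \<rightarrow>\<^sub>M M" "distr M M S = M"
    and X [measurable]: "\<And>n. X n \<in> borel_measurable M"
    and bounds: "\<And>n \<omega>. \<omega> \<in> space M \<Longrightarrow> 0 \<le> X n \<omega> \<and> X n \<omega> \<le> C * real n"
    and subadd: "\<And>m n \<omega>. \<omega> \<in> space M \<Longrightarrow> X (m + n) \<omega> \<le> X m \<omega> + X n ((S ^^ m) \<omega>)"
    and good: "AE \<omega> in M. \<exists>n\<ge>1. X n \<omega> \<le> c * real n"
    and "\<epsilon> > 0"
  shows "\<exists>n0. \<forall>n\<ge>n0. expectation (X n) \<le> (c + \<epsilon>) * real n"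
proof -
  note [measurable] = S(1)
  have [measurable]: "S ^^ n \<in> M \<rightarrow>\<^sub>M M" for n
    by (induction n) auto
  have Sn: "distr M M (S ^^ n) = M" for n
  proof (induction n)
    case (Suc n)
    have "distr M M (S ^^ Suc n) = distr (distr M M (S ^^ n)) M S"
      by (subst distr_distr) (auto simp: S(1))
    then show ?case by (simp only: Suc S(2))
  qed (simp add: distr_id id_def)
  have S_space: "(S ^^ n) \<omega> \<in> space M" if "\<omega> \<in> space M" for n \<omega>
    using measurable_space[of "S ^^ n" M M \<omega>] that by simp
  obtain \<omega> n where "\<omega> \<in> space M" "n \<ge> 1" "X n \<omega> \<le> c * real n"
    using AE_witness[OF good] by auto
  with bounds[of \<omega> n] have "c \<ge> 0"
    by (auto simp: not_less zero_le_mult_iff dest: order_trans)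
  have "C \<ge> 0" using bounds[OF \<open>\<omega> \<in> space M\<close>, of 1] by simp
  define B where "B = (\<lambda>N. {\<omega> \<in> space M. \<forall>l\<in>{1..N}. X l \<omega> > c * real l})"
  have [measurable]: "B N \<in> events" for N
    unfolding B_def by measurable
  have "(\<lambda>N. prob (B N)) \<longlonglongrightarrow> prob (\<Inter>N. B N)"
    by (rule finite_Lim_measure_decseq) (auto simp: B_def decseq_def)
  moreover have "prob (\<Inter>N. B N) = 0"
  proof -
    have "AE \<omega> in M. \<omega> \<notin> (\<Inter>N. B N)"
      using good
    proof eventually_elim
      case (elim \<omega>)
      then obtain n where "n \<ge> 1" "X n \<omega> \<le> c * real n" by auto
      then have "\<omega> \<notin> B n" by (auto simp: B_def not_less intro!: bexI[of _ n])
      then show ?case by auto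
    qed
    then show ?thesis by (simp add: prob_eq_0)
  qed
  ultimately have "(\<lambda>N. C * prob (B N)) \<longlonglongrightarrow> C * 0" by (intro tendsto_mult) auto
  then have "eventually (\<lambda>N. C * prob (B N) < \<epsilon> / 2) sequentially"
    using \<open>\<epsilon> > 0\<close> by (auto dest!: order_tendstoD(2)[where a = "\<epsilon> / 2"])
  then obtain N where N: "C * prob (B N) < \<epsilon> / 2"
    by (meson eventually_happens sequentially_bot)
  \<comment> \<open>The last summand pays for the final piece, where at most \<open>N + 1\<close> steps remain and
    a good time could overshoot \<open>n\<close>.\<close>
  have main: "X n \<omega> \<le> c * real n + C * (\<Sum>i<n. indicator (B N) ((S ^^ i) \<omega>)) + C * (real N + 1)"
    if "\<omega> \<in> space M" for n \<omega>
    using that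
  proof (induction n arbitrary: \<omega> rule: less_induct)
    case (less n)
    show ?case
    proof (cases "n \<le> N + 1")
      case True
      then have "C * real n \<le> C * (real N + 1)" using \<open>C \<ge> 0\<close> by (intro mult_left_mono) auto
      moreover have "0 \<le> C * (\<Sum>i<n. indicator (B N) ((S ^^ i) \<omega>))"
        using \<open>C \<ge> 0\<close> by (intro mult_nonneg_nonneg sum_nonneg) auto
      moreover have "0 \<le> c * real n" using \<open>c \<ge> 0\<close> by simp
      ultimately show ?thesis using bounds[OF less.prems, of n] by linarith
    next
      case False
      obtain l where l: "l \<ge> 1" "l \<le> N + 1"
        "X l \<omega> \<le> c * real l + C * (\<Sum>i<l. indicator (B N) ((S ^^ i) \<omega>))"
      proof (cases "\<omega> \<in> B N")
        case True
        have "X 1 \<omega> \<le> c * real 1 + C * (\<Sum>i<1. indicator (B N) ((S ^^ i) \<omega>))"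
          using True bounds[OF less.prems, of 1] \<open>c \<ge> 0\<close> by simp
        then show ?thesis by (rule that[rotated 2]) auto
      next
        case False
        then obtain l where "l \<in> {1..N}" "X l \<omega> \<le> c * real l"
          using less.prems by (auto simp: B_def not_less)
        moreover have "0 \<le> C * (\<Sum>i<l. indicator (B N) ((S ^^ i) \<omega>))"
          using \<open>C \<ge> 0\<close> by (intro mult_nonneg_nonneg sum_nonneg) auto
        ultimately show ?thesis by (intro that[of l]) auto
      qed
      define m where "m = n - l"
      have n: "n = l + m" and "m < n" using l False by (auto simp: m_def)
      have "X n \<omega> \<le> X l \<omega> + X m ((S ^^ l) \<omega>)"
        unfolding n by (rule subadd[OF less.prems])
      moreover have "X m ((S ^^ l) \<omega>) \<le> c * real m
          + C * (\<Sum>i<m. indicator (B N) ((S ^^ i) ((S ^^ l) \<omega>))) + C * (real N + 1)"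
        by (rule less.IH[OF \<open>m < n\<close> S_space[OF less.prems]])
      moreover have "(\<Sum>i<n. indicator (B N) ((S ^^ i) \<omega>) :: real) =
          (\<Sum>i<l. indicator (B N) ((S ^^ i) \<omega>)) + (\<Sum>i<m. indicator (B N) ((S ^^ i) ((S ^^ l) \<omega>)))"
      proof -
        have "{..<n} = {..<l} \<union> {l..<l+m}" by (auto simp: n)
        then have "(\<Sum>i<n. indicator (B N) ((S ^^ i) \<omega>) :: real) =
          (\<Sum>i<l. indicator (B N) ((S ^^ i) \<omega>)) + (\<Sum>i=l..<l+m. indicator (B N) ((S ^^ i) \<omega>))"
          by (simp add: sum.union_disjoint ivl_disj_int)
        also have "(\<Sum>i=l..<l+m. indicator (B N) ((S ^^ i) \<omega>) :: real)
            = (\<Sum>i<m. indicator (B N) ((S ^^ (i + l)) \<omega>))"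
          using sum.shift_bounds_nat_ivl[of "\<lambda>i. indicator (B N) ((S ^^ i) \<omega>) :: real" 0 l m]
          by (simp add: atLeast0LessThan add.commute)
        finally show ?thesis by (simp add: funpow_add)
      qed
      ultimately show ?thesis using l(3) by (simp add: n algebra_simps)
    qed
  qed
  have ind: "expectation (\<lambda>\<omega>. indicator (B N) ((S ^^ i) \<omega>)) = prob (B N)" for i
  proof -
    have "expectation (\<lambda>\<omega>. indicator (B N) ((S ^^ i) \<omega>) :: real)
        = integral\<^sup>L (distr M M (S ^^ i)) (indicator (B N))"
      by (subst integral_distr) auto
    then show ?thesis by (simp add: Sn)
  qed
  have int_ind: "integrable M (\<lambda>\<omega>. indicator (B N) ((S ^^ i) \<omega>) :: real)" for i
    by (rule integrable_const_bound[of _ 1]) auto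
  have "expectation (X n) \<le> (c + \<epsilon> / 2) * real n + C * (real N + 1)" for n
  proof -
    have "expectation (X n) \<le> expectation (\<lambda>\<omega>. c * real n
        + C * (\<Sum>i<n. indicator (B N) ((S ^^ i) \<omega>)) + C * (real N + 1))"
    proof (rule integral_mono)
      show "integrable M (X n)"
        by (rule integrable_const_bound[of _ "C * real n"]) (use bounds in \<open>auto intro!: AE_I2\<close>)
    qed (use main int_ind in auto)
    also have "\<dots> = c * real n + C * (real n * prob (B N)) + C * (real N + 1)"
      using int_ind by (simp add: ind prob_space)
    also have "C * (real n * prob (B N)) \<le> (\<epsilon> / 2) * real n"
      using mult_right_mono[of "C * prob (B N)" "\<epsilon> / 2" "real n"] N by (simp add: mult_ac)
    finally show ?thesis by (simp add: algebra_simps)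
  qed
  moreover obtain n0 :: nat where n0: "C * (real N + 1) \<le> (\<epsilon> / 2) * real n0"
    using reals_Archimedean3[of "\<epsilon> / 2"] \<open>\<epsilon> > 0\<close>
    by (metis half_gt_zero less_imp_le mult.commute)
  have "C * (real N + 1) \<le> (\<epsilon> / 2) * real n" if "n \<ge> n0" for n
    using n0 mult_left_mono[of "real n0" "real n" "\<epsilon> / 2"] that \<open>\<epsilon> > 0\<close> by linarith
  ultimately have "expectation (X n) \<le> (c + \<epsilon> / 2) * real n + (\<epsilon> / 2) * real n" if "n \<ge> n0" for n
    using that by (meson add_left_mono order_trans)
  then show ?thesis by (intro exI[of _ n0]) (simp add: algebra_simps)
qed

text \<open>Here \<open>f\<close> itself may fail to be integrable. Truncating \<open>f\<close> at height \<open>n\<close> is a contraction, so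
  the truncated increments keep the bound \<open>L\<close>, and dominated convergence applies.\<close>

lemma (in prob_space) expectation_coboundary_eq_0:
  fixes f :: "'a \<Rightarrow> real"
  assumes S: "S \<in> M \<rightarrow>\<^sub>M M" "distr M M S = M"
    and f [measurable]: "f \<in> borel_measurable M"
    and bound: "\<And>\<omega>. \<omega> \<in> space M \<Longrightarrow> \<bar>f (S \<omega>) - f \<omega>\<bar> \<le> L"
  shows "expectation (\<lambda>\<omega>. f (S \<omega>) - f \<omega>) = 0"
proof -
  note [measurable] = S(1)
  define g where "g = (\<lambda>(n::nat) \<omega>. max (- real n) (min (real n) (f \<omega>)))"
  have [measurable]: "g n \<in> borel_measurable M" for n unfolding g_def by measurable
  have g_int: "integrable M (g n)" for n
    by (rule integrable_const_bound[of _ "real n"]) (auto simp: g_def)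
  have "expectation (\<lambda>\<omega>. g n (S \<omega>) - g n \<omega>) = 0" for n
  proof -
    have "integrable (distr M M S) (g n)" by (simp add: S(2) g_int)
    then have "integrable M (\<lambda>\<omega>. g n (S \<omega>))" by (subst (asm) integrable_distr_eq) auto
    moreover have "expectation (\<lambda>\<omega>. g n (S \<omega>)) = integral\<^sup>L (distr M M S) (g n)"
      by (subst integral_distr) auto
    ultimately show ?thesis by (simp add: S(2) g_int)
  qed
  moreover have "(\<lambda>n. expectation (\<lambda>\<omega>. g n (S \<omega>) - g n \<omega>)) \<longlonglongrightarrow> expectation (\<lambda>\<omega>. f (S \<omega>) - f \<omega>)"
  proof (rule integral_dominated_convergence[where w = "\<lambda>_. L"])
    have "(\<lambda>n. g n \<omega>) \<longlonglongrightarrow> f \<omega>" for \<omega>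
    proof (rule tendsto_eventually)
      obtain k :: nat where "\<bar>f \<omega>\<bar> \<le> real k" using real_arch_simple by blast
      then show "eventually (\<lambda>n. g n \<omega> = f \<omega>) sequentially"
        unfolding eventually_sequentially g_def by (intro exI[of _ k]) (auto simp: max_def min_def)
    qed
    then show "AE \<omega> in M. (\<lambda>n. g n (S \<omega>) - g n \<omega>) \<longlonglongrightarrow> f (S \<omega>) - f \<omega>"
      by (intro AE_I2 tendsto_diff)
    show "AE \<omega> in M. norm (g n (S \<omega>) - g n \<omega>) \<le> L" for n
    proof (rule AE_I2)
      fix \<omega> assume "\<omega> \<in> space M"
      then show "norm (g n (S \<omega>) - g n \<omega>) \<le> L"
        using bound[of \<omega>] unfolding g_def real_norm_def by linarith
    qed
  qed auto
  ultimately show ?thesis by (simp add: LIMSEQ_const_iff)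
qed

section \<open>The zero-one law for the lattice action\<close>

context ergodic_action
begin

lemma V_space: "\<omega> \<in> space M \<Longrightarrow> V z \<omega> \<in> space M"
  using measurable_space[OF V_measurable] .

lemma V_zero:
  assumes "\<omega> \<in> space M"
  shows "V 0 \<omega> = \<omega>"
proof -
  have "V 0 (V 0 \<omega>) = V 0 \<omega>"
    using V_add[OF assms, of 0 0] by simp
  then show ?thesis
    using V_invertible[of 0] V_space assms by (auto simp: bij_betw_def dest: inj_onD)
qed

lemma V_funpow: "\<omega> \<in> space M \<Longrightarrow> (V z ^^ n) \<omega> = V (int n *s z) \<omega>"
proof (induction n)
  case (Suc n)
  have "int (Suc n) *s z = z + int n *s z" by (simp add: vec_eq_iff algebra_simps)
  then show ?case using Suc by (simp add: V_add)
qed (simp add: V_zero)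

lemma invariant_property_zero_one:
  assumes "{\<omega> \<in> space M. P \<omega>} \<in> events"
    and inv: "\<And>z \<omega>. \<omega> \<in> space M \<Longrightarrow> P \<omega> \<Longrightarrow> P (V z \<omega>)"
  shows "(AE \<omega> in M. P \<omega>) \<or> (AE \<omega> in M. \<not> P \<omega>)"
proof -
  let ?B = "{\<omega> \<in> space M. P \<omega>}"
  have "V z ` ?B = ?B" for z
  proof (intro equalityI subsetI)
    fix \<omega> assume \<omega>: "\<omega> \<in> ?B"
    then have "\<omega> = V z (V (- z) \<omega>)" using V_add[of \<omega> z "- z"] by (simp add: V_zero)
    moreover have "V (- z) \<omega> \<in> ?B" using \<omega> inv V_space by auto
    ultimately show "\<omega> \<in> V z ` ?B" by blast
  qed (use inv V_space in auto)
  then have "prob ?B = 0 \<or> prob ?B = 1" by (rule V_ergodic[OF assms(1)])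
  moreover have "(AE \<omega> in M. P \<omega>) \<longleftrightarrow> prob ?B = 1"
    using prob_Collect_eq_1[OF assms(1)] by simp
  moreover have "(AE \<omega> in M. \<not> P \<omega>) \<longleftrightarrow> prob ?B = 0"
    using prob_Collect_eq_0[OF assms(1)] by simp
  ultimately show ?thesis by blast
qed

lemma expectation_shift:
  fixes f :: "'w \<Rightarrow> real"
  assumes [measurable]: "f \<in> borel_measurable M"
  shows "expectation (\<lambda>\<omega>. f (V z \<omega>)) = expectation f"
proof -
  note [measurable] = V_measurable
  have "expectation (\<lambda>\<omega>. f (V z \<omega>)) = integral\<^sup>L (distr M M (V z)) f"
    by (subst integral_distr) auto
  then show ?thesis by (simp add: V_preserves)
qed

end

section \<open>First-passage times\<close>

definition passage_time :: "(int ^ 'd::finite \<Rightarrow> int ^ 'd \<Rightarrow> 'w \<Rightarrow> real)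
    \<Rightarrow> int ^ 'd \<Rightarrow> int ^ 'd \<Rightarrow> 'w \<Rightarrow> real" where
  "passage_time \<tau> x y \<omega> = (INF ds\<in>routes (y - x). passage \<tau> x ds \<omega>)"

text \<open>The bounds hold at every sample point. Essential bounds reduce to this case by clamping the
  weights to \<open>[a, b]\<close>.\<close>

locale bounded_weights = ergodic_action M V
  for M :: "'w measure" and V :: "int ^ 'd::finite \<Rightarrow> 'w \<Rightarrow> 'w" +
  fixes \<tau> :: "int ^ 'd \<Rightarrow> int ^ 'd \<Rightarrow> 'w \<Rightarrow> real" and a b :: real
  assumes a_pos: "0 < a"
    and weight_measurable: "\<And>x \<alpha>. \<alpha> \<in> directions \<Longrightarrow> \<tau> x \<alpha> \<in> borel_measurable M"
    and weight_stationary: "\<And>x z \<alpha> \<omega>. \<alpha> \<in> directions \<Longrightarrow> \<omega> \<in> space M \<Longrightarrow>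
      \<tau> (x + z) \<alpha> \<omega> = \<tau> x \<alpha> (V z \<omega>)"
    and weight_bounds: "\<And>x \<alpha> \<omega>. \<alpha> \<in> directions \<Longrightarrow> \<omega> \<in> space M \<Longrightarrow>
      a \<le> \<tau> x \<alpha> \<omega> \<and> \<tau> x \<alpha> \<omega> \<le> b"
begin

abbreviation T :: "int ^ 'd \<Rightarrow> int ^ 'd \<Rightarrow> 'w \<Rightarrow> real" where
  "T \<equiv> passage_time \<tau>"

lemma b_pos: "0 < b"
proof -
  obtain \<omega> where "\<omega> \<in> space M" using not_empty by blast
  moreover obtain \<alpha> :: "int ^ 'd" where "\<alpha> \<in> directions" using directions_nonempty by blast
  ultimately show ?thesis using weight_bounds[of \<alpha> \<omega> 0] a_pos by simp
qed

lemma passage_bounds: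
  assumes "\<omega> \<in> space M"
  shows "set ds \<subseteq> directions \<Longrightarrow>
    a * real (length ds) \<le> passage \<tau> x ds \<omega> \<and> passage \<tau> x ds \<omega> \<le> b * real (length ds)"
proof (induction ds arbitrary: x)
  case (Cons \<alpha> ds)
  then have "a \<le> \<tau> x \<alpha> \<omega>" "\<tau> x \<alpha> \<omega> \<le> b"
    "a * real (length ds) \<le> passage \<tau> (x + \<alpha>) ds \<omega>"
    "passage \<tau> (x + \<alpha>) ds \<omega> \<le> b * real (length ds)"
    using weight_bounds[OF _ assms] by auto
  then show ?case by (simp add: distrib_left)
qed simp

lemma passage_nonneg: "\<omega> \<in> space M \<Longrightarrow> set ds \<subseteq> directions \<Longrightarrow> 0 \<le> passage \<tau> x ds \<omega>"
  using passage_bounds[of \<omega> ds x] a_pos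
  by (meson less_imp_le mult_nonneg_nonneg of_nat_0_le_iff order_trans)

lemma passage_shift:
  assumes "\<omega> \<in> space M"
  shows "set ds \<subseteq> directions \<Longrightarrow> passage \<tau> (x + w) ds \<omega> = passage \<tau> x ds (V w \<omega>)"
proof (induction ds arbitrary: x)
  case (Cons \<alpha> ds)
  have *: "x + w + \<alpha> = (x + \<alpha>) + w" by (simp add: add_ac)
  from Cons.IH[of "x + \<alpha>"] Cons.prems show ?case
    by (simp add: weight_stationary[OF _ assms] *)
qed simp

lemma passage_measurable:
  "set ds \<subseteq> directions \<Longrightarrow> passage \<tau> x ds \<in> borel_measurable M"
proof (induction ds arbitrary: x)
  case Nil
  have "passage \<tau> x [] = (\<lambda>\<omega>. 0)" by (simp add: fun_eq_iff)
  then show ?case by simp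
next
  case (Cons \<alpha> ds)
  have "passage \<tau> x (\<alpha> # ds) = (\<lambda>\<omega>. \<tau> x \<alpha> \<omega> + passage \<tau> (x + \<alpha>) ds \<omega>)"
    by (simp add: fun_eq_iff)
  then show ?case using Cons weight_measurable by simp
qed

lemma bdd_below_passage:
  "\<omega> \<in> space M \<Longrightarrow> bdd_below ((\<lambda>ds. passage \<tau> x ds \<omega>) ` routes z)"
  by (rule bdd_belowI2[of _ 0]) (auto simp: routes_def passage_nonneg)

lemma T_le_passage:
  "\<omega> \<in> space M \<Longrightarrow> ds \<in> routes (y - x) \<Longrightarrow> T x y \<omega> \<le> passage \<tau> x ds \<omega>"
  unfolding passage_time_def by (rule cINF_lower[OF bdd_below_passage])

lemma T_greatest:
  "(\<And>ds. ds \<in> routes (y - x) \<Longrightarrow> t \<le> passage \<tau> x ds \<omega>) \<Longrightarrow> t \<le> T x y \<omega>"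
  unfolding passage_time_def by (rule cINF_greatest[OF routes_nonempty])

lemma T_approx:
  assumes "T x y \<omega> < t"
  shows "\<exists>ds\<in>routes (y - x). passage \<tau> x ds \<omega> < t"
  using T_greatest[of y x t \<omega>] assms by force

lemma T_ge:
  assumes "\<omega> \<in> space M"
  shows "a * l1 (y - x) \<le> T x y \<omega>"
proof (rule T_greatest)
  fix ds assume ds: "ds \<in> routes (y - x)"
  then have "real_of_int (l1 (y - x)) \<le> real (length ds)"
    using l1_sum_list_le[of ds] by (simp add: routes_def)
  then have "a * l1 (y - x) \<le> a * real (length ds)"
    using a_pos by (intro mult_left_mono) auto
  also have "\<dots> \<le> passage \<tau> x ds \<omega>"
    using passage_bounds[OF assms, of ds x] ds by (simp add: routes_def)
  finally show "a * l1 (y - x) \<le> passage \<tau> x ds \<omega>" .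
qed

lemma T_nonneg: "\<omega> \<in> space M \<Longrightarrow> 0 \<le> T x y \<omega>"
  by (rule T_greatest) (simp add: routes_def passage_nonneg)

lemma T_le:
  assumes "\<omega> \<in> space M"
  shows "T x y \<omega> \<le> b * l1 (y - x)"
proof -
  obtain ds where ds: "ds \<in> routes (y - x)" "int (length ds) = l1 (y - x)"
    using ex_short_route by blast
  have "T x y \<omega> \<le> passage \<tau> x ds \<omega>" by (rule T_le_passage[OF assms ds(1)])
  also have "\<dots> \<le> b * real (length ds)"
    using passage_bounds[OF assms, of ds x] ds(1) by (simp add: routes_def)
  also have "real (length ds) = l1 (y - x)" using ds(2) by (metis of_int_of_nat_eq)
  finally show ?thesis .
qed

lemma T_self [simp]: "\<omega> \<in> space M \<Longrightarrow> T x x \<omega> = 0"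
  using T_le[of \<omega> x x] T_nonneg[of \<omega> x x] by simp

lemma T_edge:
  assumes "\<omega> \<in> space M" "\<alpha> \<in> directions"
  shows "T x (x + \<alpha>) \<omega> \<le> \<tau> x \<alpha> \<omega>"
  using T_le_passage[OF assms(1), of "[\<alpha>]" "x + \<alpha>" x] assms(2) by (simp add: routes_def)

lemma T_triangle:
  assumes "\<omega> \<in> space M"
  shows "T x z \<omega> \<le> T x y \<omega> + T y z \<omega>"
proof (rule field_le_epsilon)
  fix e :: real assume "e > 0"
  then obtain ds es where ds: "ds \<in> routes (y - x)" "passage \<tau> x ds \<omega> < T x y \<omega> + e / 2"
    and es: "es \<in> routes (z - y)" "passage \<tau> y es \<omega> < T y z \<omega> + e / 2"
    using T_approx[of x y \<omega> "T x y \<omega> + e / 2"] T_approx[of y z \<omega> "T y z \<omega> + e / 2"] by auto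
  have "ds @ es \<in> routes (z - x)" using routes_append[OF ds(1) es(1)] by simp
  from T_le_passage[OF assms this] have "T x z \<omega> \<le> passage \<tau> x ds \<omega> + passage \<tau> y es \<omega>"
    using ds(1) by (simp add: passage_append routes_def)
  with ds(2) es(2) show "T x z \<omega> \<le> T x y \<omega> + T y z \<omega> + e" by simp
qed

lemma T_shift:
  assumes "\<omega> \<in> space M"
  shows "T (x + w) (y + w) \<omega> = T x y (V w \<omega>)"
  unfolding passage_time_def using passage_shift[OF assms]
  by (intro INF_cong) (auto simp: routes_def)

lemma T_measurable [measurable]: "T x y \<in> borel_measurable M"
proof -
  have "(\<lambda>\<omega>. INF ds\<in>routes (y - x). passage \<tau> x ds \<omega>) \<in> borel_measurable M"
    by (rule borel_measurable_cINF)
       (auto simp: routes_def passage_measurable bdd_below_passage[unfolded routes_def])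
  then show ?thesis by (simp add: passage_time_def[abs_def])
qed

lemma T_integrable: "integrable M (T x y)"
  by (rule integrable_const_bound[of _ "b * l1 (y - x)"]) (auto intro!: AE_I2 simp: T_nonneg T_le)

lemma T_perturb_end:
  assumes "\<omega> \<in> space M"
  shows "\<bar>T 0 y \<omega> - T 0 y' \<omega>\<bar> \<le> b * l1 (y - y')"
proof -
  have "l1 (y' - y) = l1 (y - y')" using l1_uminus[of "y - y'"] by simp
  then show ?thesis
    using T_triangle[OF assms, of 0 y y'] T_triangle[OF assms, of 0 y' y]
      T_le[OF assms, of y y'] T_le[OF assms, of y' y] by simp
qed

text \<open>The bound is uniform in \<open>y\<close>: this is what makes linear bounds on \<open>T 0 y\<close>, up to an additive
  constant, invariant under the whole action.\<close>

lemma T_shift_close: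
  assumes "\<omega> \<in> space M"
  shows "\<bar>T 0 y (V w \<omega>) - T 0 y \<omega>\<bar> \<le> 2 * b * l1 w"
proof -
  have "T 0 y (V w \<omega>) = T w (y + w) \<omega>" using T_shift[OF assms, of 0 w y] by simp
  moreover have "T w (y + w) \<omega> \<le> T w 0 \<omega> + T 0 y \<omega> + T y (y + w) \<omega>"
    using T_triangle[OF assms, of w "y + w" 0] T_triangle[OF assms, of 0 "y + w" y] by simp
  moreover have "T 0 y \<omega> \<le> T 0 w \<omega> + T w (y + w) \<omega> + T (y + w) y \<omega>"
    using T_triangle[OF assms, of 0 y w] T_triangle[OF assms, of w y "y + w"] by simp
  ultimately show ?thesis
    using T_le[OF assms, of w 0] T_le[OF assms, of 0 w] T_le[OF assms, of y "y + w"]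
      T_le[OF assms, of "y + w" y] by (simp add: algebra_simps)
qed

lemma T_ray_add:
  assumes "\<omega> \<in> space M"
  shows "T 0 (int (m + n) *s z) \<omega>
    \<le> T 0 (int m *s z) \<omega> + T 0 (int n *s z) (V (int m *s z) \<omega>)"
proof -
  have *: "int (m + n) *s z = int n *s z + int m *s z" by (simp add: vec_eq_iff algebra_simps)
  show ?thesis
    using T_triangle[OF assms, of 0 "int n *s z + int m *s z" "int m *s z"]
      T_shift[OF assms, of 0 "int m *s z" "int n *s z"] unfolding * by simp
qed

lemma T_ray_le: "\<omega> \<in> space M \<Longrightarrow> T 0 (int n *s z) \<omega> \<le> b * l1 z * real n"
  using T_le[of \<omega> 0 "int n *s z"] by (simp add: l1_scale mult_ac)

lemma T_ray_ge: "\<omega> \<in> space M \<Longrightarrow> a * l1 z * real n \<le> T 0 (int n *s z) \<omega>"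
  using T_ge[of \<omega> "int n *s z" 0] by (simp add: l1_scale mult_ac)

section \<open>Convergence along rays\<close>

text \<open>An infimum of means, so that each mean bounds it from above; the two ray bounds below identify it
  as the almost sure limit of \<open>T 0 (n z) / n\<close>.\<close>

definition time_constant :: "int ^ 'd \<Rightarrow> real" where
  "time_constant z = (INF n\<in>{1::nat..}. expectation (T 0 (int n *s z)) / real n)"

lemma expectation_ray_ge:
  "a * l1 z * real n \<le> expectation (T 0 (int n *s z))"
proof -
  have "expectation (\<lambda>_. a * l1 z * real n) \<le> expectation (T 0 (int n *s z))"
    by (rule integral_mono) (use T_integrable T_ray_ge in auto)
  then show ?thesis by (simp add: prob_space)
qed

lemma ray_mean_ge: "n \<ge> 1 \<Longrightarrow> a * l1 z \<le> expectation (T 0 (int n *s z)) / real n"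
  using expectation_ray_ge[of z n] by (simp add: pos_le_divide_eq)

lemma time_constant_ge: "a * l1 z \<le> time_constant z"
  unfolding time_constant_def by (rule cINF_greatest) (auto simp: ray_mean_ge)

lemma time_constant_le:
  "n \<ge> 1 \<Longrightarrow> time_constant z \<le> expectation (T 0 (int n *s z)) / real n"
  unfolding time_constant_def
  by (rule cINF_lower) (auto intro!: bdd_belowI2[of _ "a * l1 z"] simp: ray_mean_ge)

lemma time_constant_approx:
  assumes "time_constant z < c"
  shows "\<exists>n\<ge>1. expectation (T 0 (int n *s z)) < c * real n"
proof (rule ccontr)
  assume *: "\<not> ?thesis"
  have "c \<le> time_constant z"
    unfolding time_constant_def
    by (rule cINF_greatest) (use * in \<open>auto simp: not_less pos_le_divide_eq\<close>)
  with assms show False by simp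
qed

text \<open>The property is invariant. Were it to fail almost surely, almost every orbit would have a time with
  \<open>T 0 (n z) \<le> c * n\<close>, and the means would be asymptotically at most \<open>c * n\<close>, against
  \<open>c < time_constant z\<close>.\<close>

lemma ray_lower_bound:
  assumes "c < time_constant z"
  shows "AE \<omega> in M. \<exists>K::nat. \<forall>n. c * real n - real K \<le> T 0 (int n *s z) \<omega>"
    (is "AE \<omega> in M. ?P \<omega>")
proof -
  have "(AE \<omega> in M. ?P \<omega>) \<or> (AE \<omega> in M. \<not> ?P \<omega>)"
  proof (rule invariant_property_zero_one)
    show "{\<omega> \<in> space M. ?P \<omega>} \<in> events" by measurable
    fix w :: "int ^ 'd" and \<omega> assume \<omega>: "\<omega> \<in> space M" and "?P \<omega>"
    then obtain K :: nat where K: "c * real n - real K \<le> T 0 (int n *s z) \<omega>" for n by auto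
    obtain K' :: nat where K': "real K + 2 * b * l1 w \<le> real K'" using real_arch_simple by blast
    have "c * real n - real K' \<le> T 0 (int n *s z) (V w \<omega>)" for n
      using K[of n] K' T_shift_close[OF \<omega>, of "int n *s z" w] by linarith
    then show "?P (V w \<omega>)" by blast
  qed
  moreover have False if neg: "AE \<omega> in M. \<not> ?P \<omega>"
  proof -
    have "AE \<omega> in M. \<exists>n\<ge>1. T 0 (int n *s z) \<omega> \<le> c * real n"
      using neg
    proof (rule AE_mp, intro AE_I2 impI)
      fix \<omega> assume \<omega>: "\<omega> \<in> space M" and "\<not> ?P \<omega>"
      then have "\<not> (\<forall>n. c * real n - real 0 \<le> T 0 (int n *s z) \<omega>)" by blast
      then obtain n where n: "T 0 (int n *s z) \<omega> < c * real n" by (auto simp: not_le)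
      with \<omega> have "n \<noteq> 0" by (intro notI) simp
      with n show "\<exists>n\<ge>1. T 0 (int n *s z) \<omega> \<le> c * real n"
        by (intro exI[of _ n]) auto
    qed
    then have "\<exists>n0. \<forall>n\<ge>n0. expectation (T 0 (int n *s z))
        \<le> (c + (time_constant z - c) / 2) * real n"
      using assms T_ray_add T_nonneg T_ray_le
      by (intro expectation_subadditive_le[OF V_measurable[of z] V_preserves, where C = "b * l1 z"])
         (auto simp: V_funpow)
    then obtain n0 where n0: "\<And>n. n \<ge> n0 \<Longrightarrow> expectation (T 0 (int n *s z))
        \<le> (c + (time_constant z - c) / 2) * real n" by blast
    let ?n = "max n0 1"
    have "time_constant z \<le> expectation (T 0 (int ?n *s z)) / real ?n"
      by (rule time_constant_le) simp
    also have "\<dots> \<le> c + (time_constant z - c) / 2"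
      using n0[of ?n] by (subst pos_divide_le_eq) auto
    finally show False using assms by (simp add: field_simps)
  qed
  ultimately show ?thesis by blast
qed

text \<open>Choose \<open>m\<close> with mean of \<open>T 0 (m z)\<close> below \<open>c * m\<close>. By subadditivity \<open>T 0 (n z)\<close> is at most an orbit
  sum of \<open>f = T 0 (m z)\<close> under \<open>V (m z)\<close>, up to a constant. If the bound failed almost surely, these
  sums would exceed \<open>c * m\<close> per step infinitely often, so the additive nonnegative process \<open>Y\<close> of
  deficits \<open>C * m - f\<close> would fall below \<open>(C - c) * m\<close> per step. The subadditive inequality then
  forces the mean of \<open>f\<close> to be at least \<open>c * m\<close>.\<close>

lemma ray_upper_bound:
  assumes "time_constant z < c"
  shows "AE \<omega> in M. \<exists>K::nat. \<forall>n. T 0 (int n *s z) \<omega> \<le> c * real n + real K"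
    (is "AE \<omega> in M. ?P \<omega>")
proof -
  have "(AE \<omega> in M. ?P \<omega>) \<or> (AE \<omega> in M. \<not> ?P \<omega>)"
  proof (rule invariant_property_zero_one)
    show "{\<omega> \<in> space M. ?P \<omega>} \<in> events" by measurable
    fix w :: "int ^ 'd" and \<omega> assume \<omega>: "\<omega> \<in> space M" and "?P \<omega>"
    then obtain K :: nat where K: "T 0 (int n *s z) \<omega> \<le> c * real n + real K" for n by auto
    obtain K' :: nat where K': "real K + 2 * b * l1 w \<le> real K'" using real_arch_simple by blast
    have "T 0 (int n *s z) (V w \<omega>) \<le> c * real n + real K'" for n
      using K[of n] K' T_shift_close[OF \<omega>, of "int n *s z" w] by linarith
    then show "?P (V w \<omega>)" by blast
  qed
  moreover have False if neg: "AE \<omega> in M. \<not> ?P \<omega>"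
  proof -
    obtain m where m: "m \<ge> 1" "expectation (T 0 (int m *s z)) < c * real m"
      using time_constant_approx[OF assms] by blast
    have "0 \<le> a * l1 z" using a_pos l1_nonneg[of z] by simp
    then have "c \<ge> 0" using time_constant_ge[of z] assms by linarith
    define f where "f = T 0 (int m *s z)"
    define S where "S = V (int m *s z)"
    define C where "C = b * l1 z"
    have "C \<ge> 0" using b_pos l1_nonneg[of z] by (simp add: C_def)
    have [measurable]: "f \<in> borel_measurable M" "S \<in> M \<rightarrow>\<^sub>M M"
      by (simp_all add: f_def S_def V_measurable)
    have [measurable]: "S ^^ i \<in> M \<rightarrow>\<^sub>M M" for i by (induction i) auto
    have S_space: "(S ^^ i) \<omega> \<in> space M" if "\<omega> \<in> space M" for i \<omega>
      using measurable_space[of "S ^^ i" M M \<omega>] that by simp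
    have f_bounds: "0 \<le> f ((S ^^ i) \<omega>) \<and> f ((S ^^ i) \<omega>) \<le> C * real m" if "\<omega> \<in> space M" for i \<omega>
      using T_nonneg T_ray_le S_space[OF that] by (simp add: f_def C_def)
    have sums: "T 0 (int (q * m) *s z) \<omega> \<le> (\<Sum>i<q. f ((S ^^ i) \<omega>))" if "\<omega> \<in> space M" for q \<omega>
    proof (induction q)
      case (Suc q)
      have "T 0 (int (Suc q * m) *s z) \<omega>
          \<le> T 0 (int (q * m) *s z) \<omega> + f (V (int (q * m) *s z) \<omega>)"
        using T_ray_add[OF that, of "q * m" m z] by (simp add: f_def add.commute)
      moreover have "(S ^^ q) \<omega> = V (int (q * m) *s z) \<omega>"
        by (simp add: S_def V_funpow[OF that] vector_smult_assoc)
      ultimately show ?case using Suc by simp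
    qed (simp add: that)
    define Y where "Y = (\<lambda>(q::nat) \<omega>. \<Sum>i<q. C * real m - f ((S ^^ i) \<omega>))"
    have "AE \<omega> in M. \<exists>q\<ge>1. Y q \<omega> \<le> (C * real m - c * real m) * real q"
      using neg
    proof (rule AE_mp, intro AE_I2 impI)
      fix \<omega> assume \<omega>: "\<omega> \<in> space M" and *: "\<not> ?P \<omega>"
      \<comment> \<open>An additive constant of this size absorbs the remainder \<open>n mod m\<close> and rules out \<open>q = 0\<close>.\<close>
      obtain K :: nat where K: "C * real m \<le> real K" using real_arch_simple by blast
      from * have "\<not> (\<forall>n. T 0 (int n *s z) \<omega> \<le> c * real n + real K)" by blast
      then obtain n where n: "c * real n + real K < T 0 (int n *s z) \<omega>" by (auto simp: not_le)
      define q r where "q = n div m" and "r = n mod m"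
      have nq: "n = q * m + r" and "r < m" using m(1) by (auto simp: q_def r_def)
      have "T 0 (int r *s z) (V (int (q * m) *s z) \<omega>) \<le> C * real r"
        using T_ray_le[OF V_space[OF \<omega>]] by (simp add: C_def)
      also have "\<dots> \<le> C * real m" using \<open>r < m\<close> \<open>C \<ge> 0\<close> by (intro mult_left_mono) auto
      finally have "T 0 (int n *s z) \<omega> \<le> (\<Sum>i<q. f ((S ^^ i) \<omega>)) + C * real m"
        using T_ray_add[OF \<omega>, of "q * m" r z] sums[OF \<omega>, of q] unfolding nq by linarith
      with n K have s: "c * real n < (\<Sum>i<q. f ((S ^^ i) \<omega>))" by linarith
      have "c * real (q * m) \<le> c * real n" using \<open>c \<ge> 0\<close> by (intro mult_left_mono) (auto simp: nq)
      with s have "c * real m * real q \<le> (\<Sum>i<q. f ((S ^^ i) \<omega>))" by (simp add: mult_ac)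
      then have "Y q \<omega> \<le> (C * real m - c * real m) * real q"
        by (simp add: Y_def sum_subtractf algebra_simps)
      moreover have "q \<noteq> 0"
      proof
        assume "q = 0"
        then have "c * real n < 0" using s by simp
        moreover have "0 \<le> c * real n" using \<open>c \<ge> 0\<close> by simp
        ultimately show False by linarith
      qed
      ultimately show "\<exists>q\<ge>1. Y q \<omega> \<le> (C * real m - c * real m) * real q"
        by (intro exI[of _ q]) auto
    qed
    moreover have "0 \<le> Y q \<omega> \<and> Y q \<omega> \<le> C * real m * real q" if "\<omega> \<in> space M" for q \<omega>
    proof
      show "0 \<le> Y q \<omega>" unfolding Y_def by (intro sum_nonneg) (use f_bounds[OF that] in auto)
      show "Y q \<omega> \<le> C * real m * real q"
        unfolding Y_def using sum_bounded_above[of "{..<q}" "\<lambda>i. C * real m - f ((S ^^ i) \<omega>)" "C * real m"]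
          f_bounds[OF that] by (simp add: mult_ac)
    qed
    moreover have "Y (k + n) \<omega> \<le> Y k \<omega> + Y n ((S ^^ k) \<omega>)" for k n \<omega>
    proof -
      have "Y (k + n) \<omega> = Y k \<omega> + Y n ((S ^^ k) \<omega>)"
      proof (induction n)
        case (Suc n)
        have "(S ^^ (k + n)) \<omega> = (S ^^ n) ((S ^^ k) \<omega>)"
          by (metis add.commute comp_apply funpow_add)
        with Suc show ?case by (simp add: Y_def)
      qed (simp add: Y_def)
      then show ?thesis by simp
    qed
    moreover have "Y q \<in> borel_measurable M" for q unfolding Y_def by measurable
    ultimately have "\<exists>n0. \<forall>q\<ge>n0. expectation (Y q)
        \<le> (C * real m - c * real m + (c * real m - expectation f) / 2) * real q"
      using m(2) unfolding f_def[symmetric]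
      by (intro expectation_subadditive_le[where S = S and C = "C * real m"])
         (auto simp: S_def V_measurable V_preserves)
    then obtain n0 where n0: "\<And>q. q \<ge> n0 \<Longrightarrow> expectation (Y q)
        \<le> (C * real m - c * real m + (c * real m - expectation f) / 2) * real q" by blast
    have "expectation (Y q) = (C * real m - expectation f) * real q" for q
    proof -
      have "expectation (\<lambda>\<omega>. f ((S ^^ i) \<omega>)) = expectation f" for i
      proof -
        have "expectation (\<lambda>\<omega>. f ((S ^^ i) \<omega>)) = expectation (\<lambda>\<omega>. f (V (int i *s (int m *s z)) \<omega>))"
          by (rule Bochner_Integration.integral_cong) (auto simp: S_def V_funpow)
        then show ?thesis by (simp add: expectation_shift)
      qed
      moreover have "integrable M (\<lambda>\<omega>. f ((S ^^ i) \<omega>))" for i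
        by (rule integrable_const_bound[of _ "C * real m"]) (use f_bounds in auto)
      ultimately show ?thesis
        unfolding Y_def by (simp add: prob_space algebra_simps)
    qed
    with n0[of "max n0 1"] have "C * real m - expectation f
        \<le> C * real m - c * real m + (c * real m - expectation f) / 2"
      by (metis max.cobounded1 max.cobounded2 mult_le_cancel_right_pos of_nat_0_less_iff
          order_less_le_trans zero_less_one)
    with m(2) show False by (simp add: f_def field_simps)
  qed
  ultimately show ?thesis by blast
qed

section \<open>A uniform lower bound on path costs\<close>

text \<open>A far point \<open>y\<close> is written as \<open>n z + r\<close> with \<open>n\<close> of size \<open>l1 y / R\<close>: then \<open>z\<close> ranges over a finite set
  depending only on \<open>R\<close>, so finitely many ray bounds suffice, and \<open>l1 r\<close> is at most \<open>D n\<close> for \<open>D\<close> the dimension.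
  The gain \<open>(\<kappa>' - \<kappa>) * time_constant z\<close> per multiple of \<open>z\<close> is of order \<open>R\<close>, while the losses, namely the
  unit error in the ray bound and the cost \<open>C * D\<close> of the remainder, do not grow with \<open>R\<close>.\<close>

lemma uniform_lower_bound:
  assumes "0 \<le> \<kappa>" and dual: "\<And>z. 0 \<le> \<kappa> * time_constant z + p \<bullet> rvec z" and "\<kappa> < \<kappa>'"
  shows "AE \<omega> in M. \<exists>K::nat. \<forall>y. - real K \<le> \<kappa>' * T 0 y \<omega> + p \<bullet> rvec y"
proof -
  define C where "C = \<kappa>' * b + norm p"
  define D where "D = int CARD('d)"
  have "\<kappa>' > 0" using assms by simp
  have "C \<ge> 0" using \<open>\<kappa>' > 0\<close> b_pos by (simp add: C_def)
  have "(\<kappa>' - \<kappa>) * a > 0" using assms a_pos by simp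
  then obtain k :: nat where k: "\<kappa>' + C * D \<le> real k * ((\<kappa>' - \<kappa>) * a)"
    using reals_Archimedean3 by (metis less_imp_le)
  \<comment> \<open>Then \<open>l1 z \<ge> R - D \<ge> k\<close> below, and \<open>k\<close> is chosen so that the gain covers the losses.\<close>
  define R where "R = int k + D + 1"
  have "D \<ge> 0" "R \<ge> 1" by (simp_all add: R_def D_def)
  define Z where "Z = {z :: int ^ 'd. l1 z \<le> 2 * R + D}"
  have "finite Z" unfolding Z_def by (rule finite_l1_ball)
  have "AE \<omega> in M. \<forall>z. \<exists>K::nat. \<forall>n. (time_constant z - 1) * real n - real K \<le> T 0 (int n *s z) \<omega>"
    unfolding AE_all_countable by (intro allI ray_lower_bound) simp
  then show ?thesis
  proof (rule AE_mp, intro AE_I2 impI)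
    fix \<omega> assume \<omega>: "\<omega> \<in> space M"
    assume "\<forall>z. \<exists>K::nat. \<forall>n. (time_constant z - 1) * real n - real K \<le> T 0 (int n *s z) \<omega>"
    then obtain K :: "int ^ 'd \<Rightarrow> nat" where
      K: "(time_constant z - 1) * real n - real (K z) \<le> T 0 (int n *s z) \<omega>" for z n
      by metis
    define K0 where "K0 = (\<Sum>z\<in>Z. K z)"
    obtain K1 :: nat where K1: "norm p * R + \<kappa>' * K0 \<le> real K1" using real_arch_simple by blast
    have nonneg: "0 \<le> norm p * R" "0 \<le> \<kappa>' * K0" using \<open>R \<ge> 1\<close> \<open>\<kappa>' > 0\<close> by auto
    have "- real K1 \<le> \<kappa>' * T 0 y \<omega> + p \<bullet> rvec y" for y
    proof (cases "l1 y < R")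
      case True
      have "norm p * l1 y \<le> norm p * R" using True by (intro mult_left_mono) auto
      moreover have "0 \<le> \<kappa>' * T 0 y \<omega>" using \<open>\<kappa>' > 0\<close> T_nonneg[OF \<omega>] by simp
      ultimately show ?thesis using abs_inner_rvec_le[of p y] K1 nonneg by linarith
    next
      case False
      define n where "n = nat (l1 y div R)"
      have "l1 y div R > 0" using False \<open>R \<ge> 1\<close> by (simp add: pos_imp_zdiv_pos_iff)
      then have n: "int n = l1 y div R" "n \<ge> 1" by (auto simp: n_def)
      have yn: "R * int n \<le> l1 y" "l1 y \<le> R * int n + R"
        using \<open>R \<ge> 1\<close> mult_div_mod_eq[of R "l1 y"] pos_mod_bound[of R "l1 y"]
          pos_mod_sign[of R "l1 y"] unfolding n(1) by linarith+
      define z where "z = (\<chi> i. y $ i div int n)"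
      define r where "r = (\<chi> i. y $ i mod int n)"
      have y: "y = int n *s z + r" by (simp add: vec_eq_iff z_def r_def)
      have "l1 r \<le> (\<Sum>i\<in>(UNIV :: 'd set). int n)"
        unfolding l1_def using n(2) by (intro sum_mono) (simp add: r_def less_imp_le)
      then have r: "l1 r \<le> D * int n" by (simp add: D_def)
      have "l1 y \<le> int n * l1 z + l1 r"
        using l1_add[of "int n *s z" r] by (simp add: y l1_scale)
      then have "R * int n \<le> (l1 z + D) * int n" using yn r by (simp add: algebra_simps)
      then have z_ge: "R - D \<le> l1 z" using n(2) by simp
      have "int n * l1 z \<le> l1 y + l1 r"
        using l1_add[of y "- r"] by (simp add: y l1_scale)
      also have "\<dots> \<le> R * int n + R * int n + D * int n"
        using yn(2) r n(2) \<open>R \<ge> 1\<close> mult_left_mono[of 1 "int n" R] by linarith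
      finally have "l1 z * int n \<le> (2 * R + D) * int n" by (simp add: algebra_simps)
      then have "z \<in> Z" using n(2) by (simp add: Z_def)
      then have "K z \<le> K0" unfolding K0_def by (rule member_le_sum) (use \<open>finite Z\<close> in auto)
      then have Kz: "\<kappa>' * K z \<le> \<kappa>' * K0" using \<open>\<kappa>' > 0\<close> by (intro mult_left_mono) auto
      have "\<kappa>' * (T 0 (int n *s z) \<omega> - b * l1 r) \<le> \<kappa>' * T 0 y \<omega>"
        using T_perturb_end[OF \<omega>, of y "int n *s z"] \<open>\<kappa>' > 0\<close>
        by (intro mult_left_mono) (auto simp: y)
      moreover have "\<kappa>' * ((time_constant z - 1) * real n - real (K z)) \<le> \<kappa>' * T 0 (int n *s z) \<omega>"
        using K[of z n] \<open>\<kappa>' > 0\<close> by (intro mult_left_mono) auto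
      moreover have "p \<bullet> rvec y \<ge> real n * (p \<bullet> rvec z) - norm p * l1 r"
        using abs_inner_rvec_le[of p r] by (simp add: y rvec_add rvec_scale inner_add_right)
      moreover have "C * l1 r \<le> C * (D * int n)"
        using r \<open>C \<ge> 0\<close> by (intro mult_left_mono) (metis of_int_le_iff of_int_mult)
      moreover have "0 \<le> real n * (\<kappa>' * time_constant z + p \<bullet> rvec z - \<kappa>' - C * D)"
      proof -
        have "real k \<le> l1 z" using z_ge by (simp add: R_def)
        then have "real k * ((\<kappa>' - \<kappa>) * a) \<le> l1 z * ((\<kappa>' - \<kappa>) * a)"
          using \<open>(\<kappa>' - \<kappa>) * a > 0\<close> by (intro mult_right_mono) auto
        also have "\<dots> = (\<kappa>' - \<kappa>) * (a * l1 z)" by simp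
        also have "\<dots> \<le> (\<kappa>' - \<kappa>) * time_constant z"
          using time_constant_ge assms by (intro mult_left_mono) auto
        finally have "0 \<le> \<kappa>' * time_constant z + p \<bullet> rvec z - \<kappa>' - C * D"
          using dual[of z] k by (simp add: algebra_simps)
        then show ?thesis by simp
      qed
      ultimately show ?thesis
        using K1 nonneg Kz by (simp add: C_def algebra_simps)
    qed
    then show "\<exists>K::nat. \<forall>y. - real K \<le> \<kappa>' * T 0 y \<omega> + p \<bullet> rvec y" by blast
  qed
qed

end

section \<open>Discrete Hamiltonian and correctors\<close>

lemma discrete_hamiltonian_measurable:
  fixes \<tau> :: "int ^ 'd::finite \<Rightarrow> int ^ 'd \<Rightarrow> 'w \<Rightarrow> real"
  assumes "\<And>x \<alpha>. \<alpha> \<in> directions \<Longrightarrow> \<tau> x \<alpha> \<in> borel_measurable M"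
    and "\<phi> \<in> correctors M V"
  shows "discrete_hamiltonian \<tau> \<phi> p x \<in> borel_measurable M"
proof -
  have [measurable]: "\<phi> x \<in> borel_measurable M" for x
    using assms(2) by (simp add: correctors_def)
  have "(\<lambda>\<omega>. SUP \<alpha>\<in>directions. (- discrete_deriv \<phi> x \<alpha> \<omega> - p \<bullet> rvec \<alpha>) / \<tau> x \<alpha> \<omega>)
      \<in> borel_measurable M"
  proof (rule borel_measurable_cSUP)
    fix \<alpha> :: "int ^ 'd" assume "\<alpha> \<in> directions"
    then have [measurable]: "\<tau> x \<alpha> \<in> borel_measurable M" by (rule assms(1))
    show "(\<lambda>\<omega>. (- discrete_deriv \<phi> x \<alpha> \<omega> - p \<bullet> rvec \<alpha>) / \<tau> x \<alpha> \<omega>) \<in> borel_measurable M"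
      unfolding discrete_deriv_def by measurable
  qed (auto simp: countable_finite)
  then show ?thesis by (simp add: discrete_hamiltonian_def[abs_def])
qed

text \<open>The right-hand side is the form in which subsolutions are summed over paths and in which they are
  verified for infimal costs.\<close>

lemma discrete_hamiltonian_le_iff:
  assumes "\<And>\<alpha>. \<alpha> \<in> directions \<Longrightarrow> 0 < \<tau> x \<alpha> \<omega>"
  shows "discrete_hamiltonian \<tau> \<phi> p x \<omega> \<le> \<kappa> \<longleftrightarrow>
    (\<forall>\<alpha>\<in>directions. \<phi> x \<omega> \<le> \<kappa> * \<tau> x \<alpha> \<omega> + p \<bullet> rvec \<alpha> + \<phi> (x + \<alpha>) \<omega>)"
proof -
  have "discrete_hamiltonian \<tau> \<phi> p x \<omega> \<le> \<kappa> \<longleftrightarrow>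
    (\<forall>\<alpha>\<in>directions. (- discrete_deriv \<phi> x \<alpha> \<omega> - p \<bullet> rvec \<alpha>) / \<tau> x \<alpha> \<omega> \<le> \<kappa>)"
    unfolding discrete_hamiltonian_def by (rule cSUP_le_iff) (auto simp: directions_nonempty)
  also have "\<dots> \<longleftrightarrow> (\<forall>\<alpha>\<in>directions. \<phi> x \<omega> \<le> \<kappa> * \<tau> x \<alpha> \<omega> + p \<bullet> rvec \<alpha> + \<phi> (x + \<alpha>) \<omega>)"
    by (intro ball_cong refl)
       (auto simp: discrete_deriv_def pos_divide_le_eq[OF assms] algebra_simps)
  finally show ?thesis .
qed

lemma corrector_increment_mean_zero:
  assumes "\<phi> \<in> correctors M V"
  shows "set ds \<subseteq> directions \<Longrightarrow> integrable M (\<lambda>\<omega>. \<phi> (x + sum_list ds) \<omega> - \<phi> x \<omega>) \<and>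
    (\<integral>\<omega>. \<phi> (x + sum_list ds) \<omega> - \<phi> x \<omega> \<partial>M) = 0"
proof (induction ds arbitrary: x)
  case (Cons \<alpha> ds)
  have D: "integrable M (\<lambda>\<omega>. \<phi> (x + \<alpha>) \<omega> - \<phi> x \<omega>)" "(\<integral>\<omega>. \<phi> (x + \<alpha>) \<omega> - \<phi> x \<omega> \<partial>M) = 0"
    using assms Cons.prems by (auto simp: correctors_def discrete_deriv_def[abs_def])
  have IH: "integrable M (\<lambda>\<omega>. \<phi> (x + \<alpha> + sum_list ds) \<omega> - \<phi> (x + \<alpha>) \<omega>)"
    "(\<integral>\<omega>. \<phi> (x + \<alpha> + sum_list ds) \<omega> - \<phi> (x + \<alpha>) \<omega> \<partial>M) = 0"
    using Cons.IH[of "x + \<alpha>"] Cons.prems by auto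
  have eq: "\<phi> (x + sum_list (\<alpha> # ds)) \<omega> - \<phi> x \<omega> =
    (\<phi> (x + \<alpha> + sum_list ds) \<omega> - \<phi> (x + \<alpha>) \<omega>) + (\<phi> (x + \<alpha>) \<omega> - \<phi> x \<omega>)" for \<omega>
    by (simp add: add.assoc)
  show ?case
    unfolding eq using Bochner_Integration.integral_add[OF IH(1) D(1)]
      Bochner_Integration.integrable_add[OF IH(1) D(1)] IH D by simp
qed simp

section \<open>The effective Hamiltonian and the reach rate\<close>

context bounded_weights
begin

text \<open>The dual of the asymmetric norm \<open>time_constant\<close> at \<open>- p\<close>, that is, the supremum of
  \<open>- p \<bullet> z / time_constant z\<close> over \<open>z \<noteq> 0\<close>.\<close>

definition effective_hamiltonian :: "real ^ 'd \<Rightarrow> real" where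
  "effective_hamiltonian p = Inf {\<kappa>. 0 \<le> \<kappa> \<and> (\<forall>z. 0 \<le> \<kappa> * time_constant z + p \<bullet> rvec z)}"

lemma effective_hamiltonian_le:
  "0 \<le> \<kappa> \<Longrightarrow> (\<And>z. 0 \<le> \<kappa> * time_constant z + p \<bullet> rvec z) \<Longrightarrow> effective_hamiltonian p \<le> \<kappa>"
  unfolding effective_hamiltonian_def by (intro cInf_lower) (auto intro: bdd_belowI[of _ 0])

lemma admissible_nonempty: "{\<kappa>. 0 \<le> \<kappa> \<and> (\<forall>z. 0 \<le> \<kappa> * time_constant z + p \<bullet> rvec z)} \<noteq> {}"
proof -
  have "0 \<le> norm p / a * time_constant z + p \<bullet> rvec z" for z
  proof -
    have "norm p / a * (a * l1 z) \<le> norm p / a * time_constant z"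
      using a_pos by (intro mult_left_mono time_constant_ge) auto
    then show ?thesis using abs_inner_rvec_le[of p z] a_pos by simp
  qed
  moreover have "0 \<le> norm p / a" using a_pos by simp
  ultimately show ?thesis by blast
qed

lemma effective_hamiltonian_nonneg: "0 \<le> effective_hamiltonian p"
  unfolding effective_hamiltonian_def using admissible_nonempty by (rule cInf_greatest) auto

lemma uniform_lower_bound_above_effective:
  assumes "effective_hamiltonian p < \<kappa>"
  shows "AE \<omega> in M. \<exists>K::nat. \<forall>y. - real K \<le> \<kappa> * T 0 y \<omega> + p \<bullet> rvec y"
proof -
  obtain \<kappa>0 where "0 \<le> \<kappa>0" "\<And>z. 0 \<le> \<kappa>0 * time_constant z + p \<bullet> rvec z" "\<kappa>0 < \<kappa>"
    using cInf_lessD[OF admissible_nonempty assms[unfolded effective_hamiltonian_def]] by blast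
  then show ?thesis by (rule uniform_lower_bound)
qed

lemma time_constant_slack:
  assumes "\<kappa> * time_constant z + p \<bullet> rvec z < 0" "0 \<le> \<kappa>"
  shows "\<exists>c>time_constant z. \<kappa> * c + p \<bullet> rvec z < 0"
proof -
  have "((\<lambda>c. \<kappa> * c + p \<bullet> rvec z) \<longlongrightarrow> \<kappa> * time_constant z + p \<bullet> rvec z) (at_right (time_constant z))"
    by (intro tendsto_intros)
  from order_tendstoD(2)[OF this assms(1)]
  have "\<forall>\<^sub>F c in at_right (time_constant z). \<kappa> * c + p \<bullet> rvec z < 0 \<and> time_constant z < c"
    by (intro eventually_conj eventually_at_right_less)
  then show ?thesis
    using eventually_happens trivial_limit_at_right_real by blast
qed

lemma ray_below_effective:
  assumes "0 \<le> \<kappa>" "\<kappa> < effective_hamiltonian p"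
  shows "\<exists>z c. time_constant z < c \<and> \<kappa> * c + p \<bullet> rvec z < 0"
proof -
  obtain z where "\<kappa> * time_constant z + p \<bullet> rvec z < 0"
    using effective_hamiltonian_le[OF assms(1), of p] assms(2) by (meson not_le)
  then show ?thesis using time_constant_slack assms(1) by blast
qed

lemma reach_inf_ge:
  assumes "\<omega> \<in> space M" "0 \<le> t" "0 \<le> \<kappa>"
    and "\<And>y. - K \<le> \<kappa> * T 0 y \<omega> + p \<bullet> rvec y"
  shows "- K - \<kappa> * t \<le> reach_inf \<tau> p 0 t \<omega>"
  unfolding reach_inf_eq
proof (rule cInf_greatest)
  show "{p \<bullet> rvec (sum_list ds) |ds. set ds \<subseteq> directions \<and> passage \<tau> 0 ds \<omega> \<le> t} \<noteq> {}"
    using \<open>0 \<le> t\<close> by (auto intro!: exI[of _ "[]"])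
  fix r assume "r \<in> {p \<bullet> rvec (sum_list ds) |ds. set ds \<subseteq> directions \<and> passage \<tau> 0 ds \<omega> \<le> t}"
  then obtain ds where ds: "r = p \<bullet> rvec (sum_list ds)" "set ds \<subseteq> directions" "passage \<tau> 0 ds \<omega> \<le> t"
    by blast
  have "T 0 (sum_list ds) \<omega> \<le> t"
    using T_le_passage[OF assms(1), of ds "sum_list ds" 0] ds by (simp add: routes_def)
  then have "\<kappa> * T 0 (sum_list ds) \<omega> \<le> \<kappa> * t" using \<open>0 \<le> \<kappa>\<close> by (rule mult_left_mono)
  then show "- K - \<kappa> * t \<le> r" using assms(4)[of "sum_list ds"] ds(1) by simp
qed

lemma reach_inf_le:
  assumes "\<omega> \<in> space M" "T 0 y \<omega> < t"
  shows "reach_inf \<tau> p 0 t \<omega> \<le> p \<bullet> rvec y"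
  unfolding reach_inf_eq
proof (rule cInf_lower)
  obtain ds where "ds \<in> routes y" "passage \<tau> 0 ds \<omega> < t"
    using T_approx[OF assms(2)] by auto
  then show "p \<bullet> rvec y \<in> {p \<bullet> rvec (sum_list ds) |ds. set ds \<subseteq> directions \<and> passage \<tau> 0 ds \<omega> \<le> t}"
    by (auto simp: routes_def intro!: exI[of _ ds])
  show "bdd_below {p \<bullet> rvec (sum_list ds) |ds. set ds \<subseteq> directions \<and> passage \<tau> 0 ds \<omega> \<le> t}"
  proof (rule bdd_belowI, clarify)
    fix ds assume ds: "set ds \<subseteq> directions" "passage \<tau> 0 ds \<omega> \<le> t"
    have "real_of_int (l1 (sum_list ds)) \<le> real (length ds)"
      using l1_sum_list_le[OF ds(1)] by simp
    also have "\<dots> \<le> t / a"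
      using passage_bounds[OF assms(1) ds(1), of 0] ds(2) a_pos by (simp add: pos_le_divide_eq mult.commute)
    finally have "norm p * l1 (sum_list ds) \<le> norm p * (t / a)" by (intro mult_left_mono) auto
    then show "- (norm p * (t / a)) \<le> p \<bullet> rvec (sum_list ds)"
      using abs_inner_rvec_le[of p "sum_list ds"] by linarith
  qed
qed

lemma reach_rate_eventually_gt:
  assumes "\<epsilon> > 0"
  shows "AE \<omega> in M. \<forall>\<^sub>F t in at_top. - effective_hamiltonian p - \<epsilon> < reach_inf \<tau> p 0 t \<omega> / t"
proof -
  define \<kappa> where "\<kappa> = effective_hamiltonian p + \<epsilon> / 2"
  have \<kappa>: "0 \<le> \<kappa>" "effective_hamiltonian p < \<kappa>"
    using assms effective_hamiltonian_nonneg[of p] by (simp_all add: \<kappa>_def)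
  from uniform_lower_bound_above_effective[OF \<kappa>(2)] show ?thesis
  proof (rule AE_mp, intro AE_I2 impI)
    fix \<omega> assume \<omega>: "\<omega> \<in> space M"
      and "\<exists>K::nat. \<forall>y. - real K \<le> \<kappa> * T 0 y \<omega> + p \<bullet> rvec y"
    then obtain K :: nat where K: "- real K \<le> \<kappa> * T 0 y \<omega> + p \<bullet> rvec y" for y by blast
    have rate: "- effective_hamiltonian p - \<epsilon> < reach_inf \<tau> p 0 t \<omega> / t" if "t > 2 * real K / \<epsilon>" "t > 0" for t
    proof -
      have "real K < (\<epsilon> / 2) * t" using that(1) assms by (simp add: field_simps)
      then have "(- effective_hamiltonian p - \<epsilon>) * t < - real K - \<kappa> * t"
        by (simp add: \<kappa>_def algebra_simps)
      also have "\<dots> \<le> reach_inf \<tau> p 0 t \<omega>"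
        using \<omega> \<kappa>(1) K that(2) by (intro reach_inf_ge) auto
      finally show ?thesis using that(2) by (simp add: pos_less_divide_eq)
    qed
    show "\<forall>\<^sub>F t in at_top. - effective_hamiltonian p - \<epsilon> < reach_inf \<tau> p 0 t \<omega> / t"
      using eventually_gt_at_top[of "2 * real K / \<epsilon>"] eventually_gt_at_top[of "0::real"]
      by eventually_elim (rule rate)
  qed
qed

text \<open>The strategy is to walk along a ray \<open>z\<close> that is profitable at a rate slightly below the effective
  Hamiltonian, for as many multiples \<open>n\<close> as the time budget \<open>t\<close> allows; the case distinction keeps
  that rate nonnegative, the remaining case being settled by staying put.\<close>

lemma reach_rate_eventually_less:
  assumes "\<epsilon> > 0"
  shows "AE \<omega> in M. \<forall>\<^sub>F t in at_top. reach_inf \<tau> p 0 t \<omega> / t < - effective_hamiltonian p + \<epsilon>"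
proof (cases "effective_hamiltonian p < \<epsilon>")
  case True
  show ?thesis
  proof (rule AE_I2)
    fix \<omega> assume \<omega>: "\<omega> \<in> space M"
    have rate: "reach_inf \<tau> p 0 t \<omega> / t < - effective_hamiltonian p + \<epsilon>" if "t > 0" for t
    proof -
      have "reach_inf \<tau> p 0 t \<omega> \<le> 0" using reach_inf_le[OF \<omega>, of 0 t p] that \<omega> by simp
      then have "reach_inf \<tau> p 0 t \<omega> / t \<le> 0" using that by (simp add: divide_nonpos_pos)
      then show ?thesis using True by simp
    qed
    show "\<forall>\<^sub>F t in at_top. reach_inf \<tau> p 0 t \<omega> / t < - effective_hamiltonian p + \<epsilon>"
      using eventually_gt_at_top[of "0::real"] by eventually_elim (rule rate)
  qed
next
  case False
  define \<kappa> where "\<kappa> = effective_hamiltonian p - \<epsilon> / 2"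
  have \<kappa>: "0 \<le> \<kappa>" "\<kappa> < effective_hamiltonian p"
    using False assms by (simp_all add: \<kappa>_def field_simps)
  obtain z c where zc: "time_constant z < c" "\<kappa> * c + p \<bullet> rvec z < 0"
    using ray_below_effective[OF \<kappa>] by blast
  have "0 \<le> a * l1 z" using a_pos l1_nonneg[of z] by simp
  then have "c > 0" using time_constant_ge[of z] zc(1) by linarith
  from ray_upper_bound[OF zc(1)] show ?thesis
  proof (rule AE_mp, intro AE_I2 impI)
    fix \<omega> assume \<omega>: "\<omega> \<in> space M"
      and "\<exists>K::nat. \<forall>n. T 0 (int n *s z) \<omega> \<le> c * real n + real K"
    then obtain K :: nat where K: "T 0 (int n *s z) \<omega> \<le> c * real n + real K" for n by blast
    have rate: "reach_inf \<tau> p 0 t \<omega> / t < - effective_hamiltonian p + \<epsilon>"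
      if t: "t > real K + 1" "t > 2 * (\<kappa> * (real K + 1 + c)) / \<epsilon>" for t
    proof -
      \<comment> \<open>The unit subtracted from the budget leaves room for a route that only approximates the
        infimum \<open>T\<close>.\<close>
      define n where "n = nat \<lfloor>(t - real K - 1) / c\<rfloor>"
      have n: "real n = of_int \<lfloor>(t - real K - 1) / c\<rfloor>" using t \<open>c > 0\<close> by (simp add: n_def)
      have "real n \<le> (t - real K - 1) / c" "(t - real K - 1) / c < real n + 1"
        unfolding n by linarith+
      then have cn: "c * real n \<le> t - real K - 1" "t - real K - 1 < c * real n + c"
        using \<open>c > 0\<close> by (simp_all add: pos_le_divide_eq pos_divide_less_eq algebra_simps)
      have "reach_inf \<tau> p 0 t \<omega> \<le> p \<bullet> rvec (int n *s z)"
        using K[of n] cn(1) by (intro reach_inf_le[OF \<omega>]) linarith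
      also have "\<dots> = real n * (p \<bullet> rvec z)" by (simp add: rvec_scale)
      also have "\<dots> \<le> real n * (- (\<kappa> * c))" using zc(2) by (intro mult_left_mono) auto
      also have "\<dots> = - \<kappa> * (c * real n)" by simp
      also have "\<dots> \<le> - \<kappa> * (t - real K - 1 - c)"
        using cn(2) \<kappa>(1) by (intro mult_left_mono_neg) auto
      also have "\<dots> < (- effective_hamiltonian p + \<epsilon>) * t"
        using t(2) assms by (simp add: \<kappa>_def field_simps)
      finally show ?thesis using t(1) by (simp add: pos_divide_less_eq)
    qed
    show "\<forall>\<^sub>F t in at_top. reach_inf \<tau> p 0 t \<omega> / t < - effective_hamiltonian p + \<epsilon>"
      using eventually_gt_at_top[of "real K + 1"]
        eventually_gt_at_top[of "2 * (\<kappa> * (real K + 1 + c)) / \<epsilon>"]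
      by eventually_elim (rule rate)
  qed
qed

lemma reach_rate_tendsto:
  "AE \<omega> in M. ((\<lambda>t. reach_inf \<tau> p 0 t \<omega> / t) \<longlongrightarrow> - effective_hamiltonian p) at_top"
proof -
  let ?f = "\<lambda>\<omega> t. reach_inf \<tau> p 0 t \<omega> / t"
  let ?h = "effective_hamiltonian p"
  have "AE \<omega> in M. \<forall>j::nat. \<forall>\<^sub>F t in at_top. - ?h - inverse (real (Suc j)) < ?f \<omega> t"
    unfolding AE_all_countable by (intro allI reach_rate_eventually_gt) simp
  moreover have "AE \<omega> in M. \<forall>j::nat. \<forall>\<^sub>F t in at_top. ?f \<omega> t < - ?h + inverse (real (Suc j))"
    unfolding AE_all_countable by (intro allI reach_rate_eventually_less) simp
  ultimately show ?thesis
  proof eventually_elim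
    case (elim \<omega>)
    show ?case
    proof (rule tendstoI)
      fix e :: real assume "e > 0"
      then obtain j where j: "inverse (real (Suc j)) < e" using reals_Archimedean by blast
      from elim(1)[rule_format, of j] elim(2)[rule_format, of j]
      show "\<forall>\<^sub>F t in at_top. dist (?f \<omega> t) (- ?h) < e"
        by eventually_elim (use j in \<open>simp add: dist_real_def abs_less_iff\<close>)
    qed
  qed
qed

lemma limiting_hamiltonian_eq: "limiting_hamiltonian M \<tau> p = effective_hamiltonian p"
  unfolding limiting_hamiltonian_def
proof (rule the_equality, rule reach_rate_tendsto)
  fix h assume "AE \<omega> in M. ((\<lambda>t. reach_inf \<tau> p 0 t \<omega> / t) \<longlongrightarrow> - h) at_top"
  with reach_rate_tendsto[of p]
  have "AE \<omega> in M. - h = - effective_hamiltonian p"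
    by eventually_elim (rule tendsto_unique[OF trivial_limit_at_top_linorder])
  from AE_witness[OF this] show "h = effective_hamiltonian p" by simp
qed

section \<open>The variational formula\<close>

text \<open>The pathwise inequality \<open>\<phi> 0 \<le> \<kappa> * T 0 y + p \<bullet> y + \<phi> y\<close> is integrated for \<open>y = n z\<close>, where the
  increment of \<open>\<phi>\<close> drops out, and divided by \<open>n\<close>.\<close>

lemma effective_hamiltonian_le_of_corrector:
  assumes \<phi>: "\<phi> \<in> correctors M V"
    and "AE \<omega> in M. \<forall>x. discrete_hamiltonian \<tau> \<phi> p x \<omega> \<le> \<kappa>"
  shows "effective_hamiltonian p \<le> \<kappa>"
proof -
  define good where
    "good = (\<lambda>\<omega>. \<forall>x. \<forall>\<alpha>\<in>directions. \<phi> x \<omega> \<le> \<kappa> * \<tau> x \<alpha> \<omega> + p \<bullet> rvec \<alpha> + \<phi> (x + \<alpha>) \<omega>)"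
  have good: "AE \<omega> in M. good \<omega>"
    using assms(2)
  proof (rule AE_mp, intro AE_I2 impI)
    fix \<omega> assume \<omega>: "\<omega> \<in> space M" and "\<forall>x. discrete_hamiltonian \<tau> \<phi> p x \<omega> \<le> \<kappa>"
    moreover have "0 < \<tau> x \<alpha> \<omega>" if "\<alpha> \<in> directions" for x \<alpha>
      using weight_bounds[OF that \<omega>, of x] a_pos by linarith
    ultimately show "good \<omega>"
      using discrete_hamiltonian_le_iff[of \<tau> _ \<omega> \<phi> p \<kappa>] by (simp add: good_def)
  qed
  have path: "\<phi> x \<omega> \<le> \<kappa> * passage \<tau> x ds \<omega> + p \<bullet> rvec (sum_list ds) + \<phi> (x + sum_list ds) \<omega>"
    if "good \<omega>" "set ds \<subseteq> directions" for x ds \<omega>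
    using that(2)
  proof (induction ds arbitrary: x)
    case (Cons \<alpha> ds)
    have "\<phi> x \<omega> \<le> \<kappa> * \<tau> x \<alpha> \<omega> + p \<bullet> rvec \<alpha> + \<phi> (x + \<alpha>) \<omega>"
      using that(1) Cons.prems by (simp add: good_def)
    moreover have "\<phi> (x + \<alpha>) \<omega> \<le> \<kappa> * passage \<tau> (x + \<alpha>) ds \<omega> + p \<bullet> rvec (sum_list ds)
        + \<phi> (x + \<alpha> + sum_list ds) \<omega>"
      using Cons.IH[of "x + \<alpha>"] Cons.prems by simp
    ultimately show ?case by (simp add: rvec_add inner_add_right distrib_left add.assoc)
  qed simp
  \<comment> \<open>Going forth and back over one edge has zero displacement but positive passage time.\<close>
  have "0 \<le> \<kappa>"
  proof -
    obtain \<omega> where \<omega>: "\<omega> \<in> space M" "good \<omega>" using AE_witness[OF good] by blast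
    obtain \<alpha> :: "int ^ 'd" where \<alpha>: "\<alpha> \<in> directions" using directions_nonempty by blast
    then have ds: "set [\<alpha>, - \<alpha>] \<subseteq> directions" by (simp add: uminus_direction)
    have "0 \<le> \<kappa> * passage \<tau> 0 [\<alpha>, - \<alpha>] \<omega>" using path[OF \<omega>(2) ds, of 0] by simp
    moreover have "0 < passage \<tau> 0 [\<alpha>, - \<alpha>] \<omega>"
      using passage_bounds[OF \<omega>(1) ds, of 0] a_pos by simp
    ultimately show ?thesis by (simp add: zero_le_mult_iff)
  qed
  have T_bound: "\<phi> 0 \<omega> \<le> \<kappa> * T 0 y \<omega> + p \<bullet> rvec y + \<phi> y \<omega>" if "good \<omega>" for \<omega> y
  proof (cases "\<kappa> = 0")
    case True
    obtain ds where "ds \<in> routes y" using routes_nonempty by blast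
    then show ?thesis using path[OF that, of ds 0] True by (simp add: routes_def)
  next
    case False
    then have "\<kappa> > 0" using \<open>0 \<le> \<kappa>\<close> by simp
    have "(\<phi> 0 \<omega> - \<phi> y \<omega> - p \<bullet> rvec y) / \<kappa> \<le> T 0 y \<omega>"
    proof (rule T_greatest)
      fix ds assume "ds \<in> routes (y - 0)"
      then show "(\<phi> 0 \<omega> - \<phi> y \<omega> - p \<bullet> rvec y) / \<kappa> \<le> passage \<tau> 0 ds \<omega>"
        using path[OF that, of ds 0] \<open>\<kappa> > 0\<close>
        by (simp add: routes_def pos_divide_le_eq algebra_simps)
    qed
    then show ?thesis using \<open>\<kappa> > 0\<close> by (simp add: pos_divide_le_eq algebra_simps)
  qed
  have mean: "0 \<le> \<kappa> * expectation (T 0 y) + p \<bullet> rvec y" for y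
  proof -
    obtain ds where "ds \<in> routes y" using routes_nonempty by blast
    then have incr: "integrable M (\<lambda>\<omega>. \<phi> y \<omega> - \<phi> 0 \<omega>)" "expectation (\<lambda>\<omega>. \<phi> y \<omega> - \<phi> 0 \<omega>) = 0"
      using corrector_increment_mean_zero[OF \<phi>, of ds 0] by (auto simp: routes_def)
    have "AE \<omega> in M. 0 \<le> (\<kappa> * T 0 y \<omega> + p \<bullet> rvec y) + (\<phi> y \<omega> - \<phi> 0 \<omega>)"
      using good
    proof eventually_elim
      case (elim \<omega>)
      then show ?case using T_bound[OF elim, of y] by linarith
    qed
    then have "0 \<le> expectation (\<lambda>\<omega>. (\<kappa> * T 0 y \<omega> + p \<bullet> rvec y) + (\<phi> y \<omega> - \<phi> 0 \<omega>))"
      by (rule integral_nonneg_AE)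
    also have "\<dots> = expectation (\<lambda>\<omega>. \<kappa> * T 0 y \<omega> + p \<bullet> rvec y) + expectation (\<lambda>\<omega>. \<phi> y \<omega> - \<phi> 0 \<omega>)"
      by (rule Bochner_Integration.integral_add) (use T_integrable incr in auto)
    also have "\<dots> = \<kappa> * expectation (T 0 y) + p \<bullet> rvec y"
      using T_integrable by (simp add: incr prob_space)
    finally show ?thesis .
  qed
  have "0 \<le> \<kappa> * time_constant z + p \<bullet> rvec z" for z
  proof (rule ccontr)
    assume "\<not> ?thesis"
    then obtain c where c: "time_constant z < c" "\<kappa> * c + p \<bullet> rvec z < 0"
      using time_constant_slack \<open>0 \<le> \<kappa>\<close> by (meson not_le)
    then obtain n where n: "n \<ge> 1" "expectation (T 0 (int n *s z)) < c * real n"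
      using time_constant_approx by blast
    have "\<kappa> * expectation (T 0 (int n *s z)) \<le> \<kappa> * (c * real n)"
      using n(2) \<open>0 \<le> \<kappa>\<close> by (intro mult_left_mono) auto
    then have "0 \<le> real n * (\<kappa> * c + p \<bullet> rvec z)"
      using mean[of "int n *s z"] by (simp add: rvec_scale algebra_simps)
    with c(2) n(1) show False by (simp add: zero_le_mult_iff)
  qed
  with \<open>0 \<le> \<kappa>\<close> show ?thesis by (rule effective_hamiltonian_le)
qed

text \<open>The infimal cost \<open>inf\<^sub>y (\<kappa> * T x y + p \<bullet> (y - x))\<close> of all paths from \<open>x\<close> is stationary in \<open>x\<close>. It is finite
  on the invariant event \<open>G\<close> of full probability; outside \<open>G\<close> the corrector is set to zero, which
  keeps stationarity at every sample point, as membership in \<open>correctors\<close> demands. Its increments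
  are bounded since crossing an edge in either direction costs at most \<open>\<kappa> * b + norm p\<close>.\<close>

lemma ex_corrector:
  assumes "effective_hamiltonian p < \<kappa>"
  shows "\<exists>\<phi>\<in>correctors M V. AE \<omega> in M. \<forall>x. discrete_hamiltonian \<tau> \<phi> p x \<omega> \<le> \<kappa>"
proof -
  have "\<kappa> > 0" using assms effective_hamiltonian_nonneg[of p] by linarith
  define G where "G = (\<lambda>\<omega>. \<exists>K::nat. \<forall>y. - real K \<le> \<kappa> * T 0 y \<omega> + p \<bullet> rvec y)"
  have G_AE: "AE \<omega> in M. G \<omega>"
    unfolding G_def by (rule uniform_lower_bound_above_effective[OF assms])
  have [measurable]: "Measurable.pred M G" unfolding G_def by measurable
  have G_shift: "G (V w \<omega>)" if \<omega>: "\<omega> \<in> space M" and "G \<omega>" for w \<omega>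
  proof -
    obtain K :: nat where K: "- real K \<le> \<kappa> * T 0 y \<omega> + p \<bullet> rvec y" for y
      using \<open>G \<omega>\<close> by (auto simp: G_def)
    obtain K' :: nat where K': "real K + \<kappa> * (2 * b * l1 w) \<le> real K'" using real_arch_simple by blast
    have "- real K' \<le> \<kappa> * T 0 y (V w \<omega>) + p \<bullet> rvec y" for y
    proof -
      have "\<kappa> * (T 0 y \<omega> - 2 * b * l1 w) \<le> \<kappa> * T 0 y (V w \<omega>)"
        using T_shift_close[OF \<omega>, of y w] \<open>\<kappa> > 0\<close> by (intro mult_left_mono) auto
      then show ?thesis using K[of y] K' by (simp add: algebra_simps)
    qed
    then show ?thesis by (auto simp: G_def)
  qed
  have G_iff: "G (V w \<omega>) \<longleftrightarrow> G \<omega>" if \<omega>: "\<omega> \<in> space M" for w \<omega>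
  proof
    assume "G (V w \<omega>)"
    then have "G (V (- w) (V w \<omega>))" by (rule G_shift[OF V_space[OF \<omega>]])
    then show "G \<omega>" using V_add[OF \<omega>, of "- w" w] by (simp add: V_zero \<omega>)
  qed (rule G_shift[OF \<omega>])
  define U where "U = (\<lambda>x y \<omega>. if G \<omega> then \<kappa> * T x y \<omega> + p \<bullet> rvec (y - x) else 0)"
  define \<phi> where "\<phi> = (\<lambda>x \<omega>. INF y. U x y \<omega>)"
  have U_shift: "U (x + w) (y + w) \<omega> = U x y (V w \<omega>)" if "\<omega> \<in> space M" for x y w \<omega>
    by (simp add: U_def G_iff[OF that] T_shift[OF that])
  have U_bdd0: "bdd_below (range (\<lambda>y. U 0 y \<omega>))" for \<omega>
  proof (cases "G \<omega>")
    case True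
    then obtain K :: nat where "- real K \<le> \<kappa> * T 0 y \<omega> + p \<bullet> rvec y" for y by (auto simp: G_def)
    then show ?thesis by (intro bdd_belowI2[of _ "- real K"]) (auto simp: U_def)
  qed (simp add: U_def)
  have range_shift: "range (\<lambda>y. U (x + w) y \<omega>) = range (\<lambda>y. U x y (V w \<omega>))"
    if "\<omega> \<in> space M" for x w \<omega>
  proof -
    \<comment> \<open>Reindexing by the translation \<open>y \<mapsto> y + w\<close> leaves the infimum over all targets unchanged.\<close>
    have "range (\<lambda>y. U (x + w) y \<omega>) = (\<lambda>y. U (x + w) y \<omega>) ` range (\<lambda>y. y + w)"
      by (simp add: surj_def)
    also have "\<dots> = range (\<lambda>y. U x y (V w \<omega>))"
      unfolding image_image U_shift[OF that] ..
    finally show ?thesis .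
  qed
  have U_bdd: "bdd_below (range (\<lambda>y. U x y \<omega>))" if "\<omega> \<in> space M" for x \<omega>
    using range_shift[OF that, of 0 x] U_bdd0 by simp
  have \<phi>_shift: "\<phi> (x + w) \<omega> = \<phi> x (V w \<omega>)" if "\<omega> \<in> space M" for x w \<omega>
    unfolding \<phi>_def range_shift[OF that] ..
  have [measurable]: "U x y \<in> borel_measurable M" for x y unfolding U_def by measurable
  have [measurable]: "\<phi> x \<in> borel_measurable M" for x
    unfolding \<phi>_def by (rule borel_measurable_cINF) (auto simp: U_bdd)
  have step: "\<phi> x \<omega> \<le> \<kappa> * \<tau> x \<alpha> \<omega> + p \<bullet> rvec \<alpha> + \<phi> (x + \<alpha>) \<omega>"
    if \<omega>: "\<omega> \<in> space M" and \<alpha>: "\<alpha> \<in> directions" and "G \<omega>" for x \<alpha> \<omega>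
  proof -
    have "\<phi> x \<omega> - (\<kappa> * \<tau> x \<alpha> \<omega> + p \<bullet> rvec \<alpha>) \<le> U (x + \<alpha>) y \<omega>" for y
    proof -
      have "\<phi> x \<omega> \<le> U x y \<omega>" unfolding \<phi>_def by (rule cINF_lower[OF U_bdd[OF \<omega>]]) simp
      moreover have "\<kappa> * T x y \<omega> \<le> \<kappa> * (\<tau> x \<alpha> \<omega> + T (x + \<alpha>) y \<omega>)"
        using T_triangle[OF \<omega>, of x y "x + \<alpha>"] T_edge[OF \<omega> \<alpha>, of x] \<open>\<kappa> > 0\<close>
        by (intro mult_left_mono) auto
      ultimately show ?thesis
        using \<open>G \<omega>\<close> by (simp add: U_def rvec_diff rvec_add inner_diff_right inner_add_right algebra_simps)
    qed
    then have "\<phi> x \<omega> - (\<kappa> * \<tau> x \<alpha> \<omega> + p \<bullet> rvec \<alpha>) \<le> \<phi> (x + \<alpha>) \<omega>"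
      unfolding \<phi>_def by (intro cINF_greatest) auto
    then show ?thesis by simp
  qed
  define L where "L = \<kappa> * b + norm p"
  have deriv_bound: "\<bar>\<phi> (x + \<alpha>) \<omega> - \<phi> x \<omega>\<bar> \<le> L"
    if \<omega>: "\<omega> \<in> space M" and \<alpha>: "\<alpha> \<in> directions" for x \<alpha> \<omega>
  proof (cases "G \<omega>")
    case True
    have one: "\<phi> x \<omega> - \<phi> (x + \<alpha>) \<omega> \<le> L" if "\<alpha> \<in> directions" for x \<alpha>
    proof -
      have "\<kappa> * \<tau> x \<alpha> \<omega> \<le> \<kappa> * b"
        using weight_bounds[OF that \<omega>, of x] \<open>\<kappa> > 0\<close> by (intro mult_left_mono) auto
      moreover have "p \<bullet> rvec \<alpha> \<le> norm p"
        using abs_inner_rvec_le[of p \<alpha>] l1_direction[OF that] by simp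
      ultimately show ?thesis using step[OF \<omega> that True, of x] by (simp add: L_def)
    qed
    from one[OF \<alpha>, of x] one[OF uminus_direction[OF \<alpha>], of "x + \<alpha>"] show ?thesis by simp
  next
    case False
    have "\<phi> x \<omega> = 0" for x using False by (simp add: \<phi>_def U_def)
    moreover have "0 \<le> L" using \<open>\<kappa> > 0\<close> b_pos by (simp add: L_def)
    ultimately show ?thesis by simp
  qed
  have "\<phi> \<in> correctors M V"
    unfolding correctors_def mem_Collect_eq
  proof (intro conjI allI ballI)
    fix x z \<alpha> :: "int ^ 'd" and \<omega> assume \<omega>: "\<omega> \<in> space M"
    have "x + z + \<alpha> = x + \<alpha> + z" by (simp add: add_ac)
    then show "discrete_deriv \<phi> (x + z) \<alpha> \<omega> = discrete_deriv \<phi> x \<alpha> (V z \<omega>)"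
      unfolding discrete_deriv_def by (simp only: \<phi>_shift[OF \<omega>])
  next
    fix x \<alpha> :: "int ^ 'd" assume \<alpha>: "\<alpha> \<in> directions"
    show "integrable M (discrete_deriv \<phi> x \<alpha>)"
      unfolding discrete_deriv_def[abs_def]
      by (rule integrable_const_bound[of _ L]) (use deriv_bound \<alpha> in auto)
    have "expectation (discrete_deriv \<phi> x \<alpha>) = expectation (\<lambda>\<omega>. \<phi> x (V \<alpha> \<omega>) - \<phi> x \<omega>)"
      by (rule Bochner_Integration.integral_cong) (auto simp: discrete_deriv_def \<phi>_shift)
    also have "\<dots> = 0"
      by (rule expectation_coboundary_eq_0[OF V_measurable V_preserves, where L = L])
         (use deriv_bound[OF _ \<alpha>, of _ x] \<phi>_shift in auto)
    finally show "expectation (discrete_deriv \<phi> x \<alpha>) = 0" .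
  qed simp
  moreover have "AE \<omega> in M. \<forall>x. discrete_hamiltonian \<tau> \<phi> p x \<omega> \<le> \<kappa>"
    using G_AE
  proof (rule AE_mp, intro AE_I2 impI allI)
    fix \<omega> x assume \<omega>: "\<omega> \<in> space M" "G \<omega>"
    have "0 < \<tau> x \<alpha> \<omega>" if "\<alpha> \<in> directions" for \<alpha>
      using weight_bounds[OF that \<omega>(1), of x] a_pos by linarith
    then show "discrete_hamiltonian \<tau> \<phi> p x \<omega> \<le> \<kappa>"
      using step[OF \<omega>(1) _ \<omega>(2)] by (subst discrete_hamiltonian_le_iff) auto
  qed
  ultimately show ?thesis by blast
qed

lemma limiting_hamiltonian_variational:
  "ereal (limiting_hamiltonian M \<tau> p) =
    (INF \<phi>\<in>correctors M V. esssup M (\<lambda>\<omega>. SUP x. ereal (discrete_hamiltonian \<tau> \<phi> p x \<omega>)))"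
  unfolding limiting_hamiltonian_eq
proof (rule antisym)
  show "ereal (effective_hamiltonian p) \<le>
    (INF \<phi>\<in>correctors M V. esssup M (\<lambda>\<omega>. SUP x. ereal (discrete_hamiltonian \<tau> \<phi> p x \<omega>)))"
  proof (rule INF_greatest, rule ccontr)
    fix \<phi> assume \<phi>: "\<phi> \<in> correctors M V"
    let ?E = "esssup M (\<lambda>\<omega>. SUP x. ereal (discrete_hamiltonian \<tau> \<phi> p x \<omega>))"
    assume "\<not> ereal (effective_hamiltonian p) \<le> ?E"
    then obtain \<kappa> where \<kappa>: "?E < ereal \<kappa>" "ereal \<kappa> < ereal (effective_hamiltonian p)"
      using ereal_dense2[of ?E "ereal (effective_hamiltonian p)"] unfolding not_le by blast
    have "AE \<omega> in M. (SUP x. ereal (discrete_hamiltonian \<tau> \<phi> p x \<omega>)) \<le> ?E" by (rule esssup_AE)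
    then have "AE \<omega> in M. \<forall>x. discrete_hamiltonian \<tau> \<phi> p x \<omega> \<le> \<kappa>"
    proof eventually_elim
      case (elim \<omega>)
      have "(SUP x. ereal (discrete_hamiltonian \<tau> \<phi> p x \<omega>)) \<le> ereal \<kappa>" using elim \<kappa>(1) by simp
      then show ?case by (simp add: SUP_le_iff)
    qed
    from effective_hamiltonian_le_of_corrector[OF \<phi> this] \<kappa>(2) show False by simp
  qed
next
  show "(INF \<phi>\<in>correctors M V. esssup M (\<lambda>\<omega>. SUP x. ereal (discrete_hamiltonian \<tau> \<phi> p x \<omega>)))
    \<le> ereal (effective_hamiltonian p)"
  proof (rule ereal_le_epsilon2)
    fix e :: real assume "0 < e"
    then obtain \<phi> where \<phi>: "\<phi> \<in> correctors M V"
      "AE \<omega> in M. \<forall>x. discrete_hamiltonian \<tau> \<phi> p x \<omega> \<le> effective_hamiltonian p + e"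
      using ex_corrector[of p "effective_hamiltonian p + e"] by auto
    have [measurable]: "discrete_hamiltonian \<tau> \<phi> p x \<in> borel_measurable M" for x
      by (rule discrete_hamiltonian_measurable[OF weight_measurable \<phi>(1)])
    have "esssup M (\<lambda>\<omega>. SUP x. ereal (discrete_hamiltonian \<tau> \<phi> p x \<omega>))
        \<le> ereal (effective_hamiltonian p + e)"
    proof (rule esssup_I)
      show "AE \<omega> in M. (SUP x. ereal (discrete_hamiltonian \<tau> \<phi> p x \<omega>))
          \<le> ereal (effective_hamiltonian p + e)"
        using \<phi>(2) by eventually_elim (auto intro: SUP_least)
    qed measurable
    then show "(INF \<phi>\<in>correctors M V. esssup M (\<lambda>\<omega>. SUP x. ereal (discrete_hamiltonian \<tau> \<phi> p x \<omega>)))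
      \<le> ereal (effective_hamiltonian p) + ereal e"
      using \<phi>(1) by (auto intro: INF_lower2)
  qed
qed

end

lemma (in prob_space) weights_ess_bounds:
  fixes \<tau> :: "int ^ 'd::finite \<Rightarrow> int ^ 'd \<Rightarrow> 'a \<Rightarrow> real"
  assumes "ereal a = essinf (weight_space M) (weight \<tau>)"
    and "ereal b = esssup (weight_space M) (weight \<tau>)"
  shows "AE \<omega> in M. \<forall>x. \<forall>\<alpha>\<in>directions. a \<le> \<tau> x \<alpha> \<omega> \<and> \<tau> x \<alpha> \<omega> \<le> b"
proof -
  let ?E = "UNIV \<times> directions :: ((int ^ 'd) \<times> (int ^ 'd)) set"
  have "countable ?E" by simp
  interpret E: sigma_finite_measure "count_space ?E"
    by (rule sigma_finite_measure_count_space_countable) simp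
  interpret P: pair_sigma_finite "count_space ?E" M ..
  have "AE e in count_space ?E \<Otimes>\<^sub>M M. weight \<tau> e \<le> ereal b"
    unfolding assms(2) weight_space_def[symmetric] by (rule esssup_AE)
  from P.AE_pair[OF this] have b: "AE \<omega> in M. weight \<tau> (e, \<omega>) \<le> ereal b" if "e \<in> ?E" for e
    using that by (auto simp: AE_count_space)
  have "AE e in count_space ?E \<Otimes>\<^sub>M M. - weight \<tau> e \<le> - ereal a"
    unfolding assms(1) essinf_def weight_space_def[symmetric] ereal_uminus_uminus by (rule esssup_AE)
  from P.AE_pair[OF this] have a: "AE \<omega> in M. - weight \<tau> (e, \<omega>) \<le> - ereal a" if "e \<in> ?E" for e
    using that by (auto simp: AE_count_space)
  have "AE \<omega> in M. \<forall>e\<in>?E. weight \<tau> (e, \<omega>) \<le> ereal b \<and> - weight \<tau> (e, \<omega>) \<le> - ereal a"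
    using a b by (subst AE_ball_countable[OF \<open>countable ?E\<close>]) auto
  then show ?thesis by eventually_elim (auto simp: weight_def)
qed

text \<open>Clamping the weights to \<open>[a, b]\<close> changes them only on a null set common to all edges and preserves
  stationarity; both sides of the formula depend on the weights only up to such null sets.\<close>

theorem theorem1p5:
  fixes M :: "'w measure"
    and V :: "int ^ 'd::finite \<Rightarrow> 'w \<Rightarrow> 'w"
    and \<tau> :: "int ^ 'd \<Rightarrow> int ^ 'd \<Rightarrow> 'w \<Rightarrow> real"
    and a b :: real
    and p :: "real ^ 'd"
  assumes "ergodic_action M V"
    and "\<And>x \<alpha>. \<alpha> \<in> directions \<Longrightarrow> \<tau> x \<alpha> \<in> borel_measurable M"
    and "\<And>x z \<alpha> \<omega>. \<alpha> \<in> directions \<Longrightarrow> \<omega> \<in> space M \<Longrightarrow> \<tau> (x + z) \<alpha> \<omega> = \<tau> x \<alpha> (V z \<omega>)"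
    and "ereal a = essinf (weight_space M) (weight \<tau>)"
    and "ereal b = esssup (weight_space M) (weight \<tau>)"
    and "0 < a"
  shows "ereal (limiting_hamiltonian M \<tau> p) =
    (INF \<phi>\<in>correctors M V.
       esssup M (\<lambda>\<omega>. SUP x. ereal (discrete_hamiltonian \<tau> \<phi> p x \<omega>)))"
proof -
  interpret ergodic_action M V by fact
  have ess: "AE \<omega> in M. \<forall>x. \<forall>\<alpha>\<in>directions. a \<le> \<tau> x \<alpha> \<omega> \<and> \<tau> x \<alpha> \<omega> \<le> b"
    using assms(4,5) by (rule weights_ess_bounds)
  have "a \<le> b"
  proof -
    obtain \<alpha> :: "int ^ 'd" where "\<alpha> \<in> directions" using directions_nonempty by blast
    with AE_witness[OF ess] show ?thesis by (meson order_trans)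
  qed
  define \<sigma> where "\<sigma> = (\<lambda>x \<alpha> \<omega>. max a (min b (\<tau> x \<alpha> \<omega>)))"
  have eq: "AE \<omega> in M. \<forall>x. \<forall>\<alpha>\<in>directions. \<tau> x \<alpha> \<omega> = \<sigma> x \<alpha> \<omega>"
    using ess by eventually_elim (auto simp: \<sigma>_def)
  have meas: "\<sigma> x \<alpha> \<in> borel_measurable M" if "\<alpha> \<in> directions" for x \<alpha>
    using assms(2)[OF that, of x] unfolding \<sigma>_def by measurable
  interpret bounded_weights M V \<sigma> a b
    by standard (use assms(3,6) meas \<open>a \<le> b\<close> in \<open>auto simp: \<sigma>_def\<close>)
  have "limiting_hamiltonian M \<tau> p = limiting_hamiltonian M \<sigma> p"
  proof -
    have "AE \<omega> in M. \<forall>t. reach_inf \<tau> p 0 t \<omega> = reach_inf \<sigma> p 0 t \<omega>"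
      using eq by eventually_elim (auto intro: reach_inf_cong)
    then have "(AE \<omega> in M. ((\<lambda>t. reach_inf \<tau> p 0 t \<omega> / t) \<longlongrightarrow> - h) at_top) \<longleftrightarrow>
        (AE \<omega> in M. ((\<lambda>t. reach_inf \<sigma> p 0 t \<omega> / t) \<longlongrightarrow> - h) at_top)" for h
      by (intro eventually_cong) (auto elim: eventually_mono)
    then show ?thesis by (simp add: limiting_hamiltonian_def)
  qed
  moreover have "esssup M (\<lambda>\<omega>. SUP x. ereal (discrete_hamiltonian \<tau> \<phi> p x \<omega>)) =
      esssup M (\<lambda>\<omega>. SUP x. ereal (discrete_hamiltonian \<sigma> \<phi> p x \<omega>))"
    if \<phi>: "\<phi> \<in> correctors M V" for \<phi>
  proof (rule esssup_AE_cong)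
    have [measurable]: "discrete_hamiltonian \<tau> \<phi> p x \<in> borel_measurable M"
      "discrete_hamiltonian \<sigma> \<phi> p x \<in> borel_measurable M" for x
      by (rule discrete_hamiltonian_measurable[OF _ \<phi>]; fact assms(2) meas)+
    show "(\<lambda>\<omega>. SUP x. ereal (discrete_hamiltonian \<tau> \<phi> p x \<omega>)) \<in> borel_measurable M"
      "(\<lambda>\<omega>. SUP x. ereal (discrete_hamiltonian \<sigma> \<phi> p x \<omega>)) \<in> borel_measurable M"
      by measurable
    show "AE \<omega> in M. (SUP x. ereal (discrete_hamiltonian \<tau> \<phi> p x \<omega>)) =
        (SUP x. ereal (discrete_hamiltonian \<sigma> \<phi> p x \<omega>))"
      using eq by eventually_elim (simp add: discrete_hamiltonian_def cong: SUP_cong_simp)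
  qed
  ultimately show ?thesis by (simp add: limiting_hamiltonian_variational)
qed

end
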